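(* Suppose that $1<p<\infty$, $\gamma>1$, and let $\mu$ be a positive Borel measure on $[0,1)$ which is a $\gamma$-logarithmic $1$-Carleson measure. Then the operator $\mathcal H_\mu$ is a bounded operator from $B^p$ into itself.
   Context: $\mathbb D=\{z\in\mathbb C:|z|<1\}$, and $dA(z)=\frac{dx\,dy}{\pi}$. For $1<p<\infty$ the analytic Besov space $B^p$ is the set of analytic functions $f$ in $\mathbb D$ with $\|f\|_{B^p}=\left(|f(0)|^p+\rho_p(f)^p\right)^{1/p}<\infty$, where $\rho_p(f)=\left(\int_{\mathbb D}(1-|z|^2)^{p-2}|f'(z)|^p\,dA(z)\right)^{1/p}$. For $\alpha\ge0$ and $s>0$, a positive Borel measure $\mu$ on $[0,1)$ is an $\alpha$-logarithmic $s$-Carleson measure if there is $C>0$ with $\mu([t,1))\left(\log\frac{2}{1-t}\right)^\alpha\le C(1-t)^s$ for all $0\le t<1$. For a finite positive Borel measure $\mu$ on $[0,1)$, $\mu_n=\int_{[0,1)}t^n\,d\mu(t)$, and for $f(z)=\sum_{k\ge0}a_kz^k$ analytic in $\mathbb D$, $$\mathcal H_\mu(f)(z)=\sum_{n=0}^\infty\Big(\sum_{k=0}^\infty\mu_{n+k}a_k\Big)z^n,$$ whenever the right-hand side makes sense and defines an analytic function in $\mathbb D$; boundedness of $\mathcal H_\mu$ on a space includes that it is well defined for every $f$ in the space. *)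

theory Defs
  imports "HOL-Complex_Analysis.Complex_Analysis"
begin

abbreviation unit_disc :: "complex set" where
  "unit_disc \<equiv> ball 0 1"

definition disc_area :: "complex measure" where
  "disc_area = density (restrict_space lborel unit_disc) (\<lambda>_. ennreal (1 / pi))"

text \<open>Functions on the disc are represented by total functions; the values outside the disc
  play no role in any of the definitions below. The norm is only meaningful on the Besov space,
  where finiteness of the norm is expressed by integrability of the nonnegative integrand.\<close>

definition besov_integrand :: "real \<Rightarrow> (complex \<Rightarrow> complex) \<Rightarrow> complex \<Rightarrow> real" where
  "besov_integrand p f z = (1 - (cmod z)\<^sup>2) powr (p - 2) * cmod (deriv f z) powr p"

definition besov_space :: "real \<Rightarrow> (complex \<Rightarrow> complex) set" where
  "besov_space p =
     {f. f holomorphic_on unit_disc \<and> integrable disc_area (besov_integrand p f)}"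

definition besov_seminorm :: "real \<Rightarrow> (complex \<Rightarrow> complex) \<Rightarrow> real" where
  "besov_seminorm p f = (LINT z|disc_area. besov_integrand p f z) powr (1 / p)"

definition besov_norm :: "real \<Rightarrow> (complex \<Rightarrow> complex) \<Rightarrow> real" where
  "besov_norm p f = (cmod (f 0) powr p + besov_seminorm p f powr p) powr (1 / p)"

definition borel_measure_on_01 :: "real measure \<Rightarrow> bool" where
  "borel_measure_on_01 \<mu> \<longleftrightarrow> sets \<mu> = sets (restrict_space borel {0..<1})"

text \<open>The extended measure is used, so that the condition (at \<open>t = 0\<close>) forces finiteness.\<close>

definition log_carleson :: "real \<Rightarrow> real \<Rightarrow> real measure \<Rightarrow> bool" where
  "log_carleson \<alpha> s \<mu> \<longleftrightarrow>
     (\<exists>C>0. \<forall>t. 0 \<le> t \<and> t < 1 \<longrightarrow>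
        emeasure \<mu> {t..<1} * ennreal (ln (2 / (1 - t)) powr \<alpha>) \<le> ennreal (C * (1 - t) powr s))"

definition moment :: "real measure \<Rightarrow> nat \<Rightarrow> real" where
  "moment \<mu> n = (LINT t|\<mu>. t ^ n)"

definition hankel_term :: "real measure \<Rightarrow> (complex \<Rightarrow> complex) \<Rightarrow> nat \<Rightarrow> nat \<Rightarrow> complex" where
  "hankel_term \<mu> f n k = of_real (moment \<mu> (n + k)) * fps_nth (fps_expansion f 0) k"

definition hankel_coeff :: "real measure \<Rightarrow> (complex \<Rightarrow> complex) \<Rightarrow> nat \<Rightarrow> complex" where
  "hankel_coeff \<mu> f n = (\<Sum>k. hankel_term \<mu> f n k)"

definition hankel_op :: "real measure \<Rightarrow> (complex \<Rightarrow> complex) \<Rightarrow> complex \<Rightarrow> complex" where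
  "hankel_op \<mu> f z = (\<Sum>n. hankel_coeff \<mu> f n * z ^ n)"

text \<open>Since \<^const>\<open>suminf\<close> is total, convergence of all the series involved is a separate
  condition.\<close>

definition hankel_op_well_defined :: "real measure \<Rightarrow> (complex \<Rightarrow> complex) \<Rightarrow> bool" where
  "hankel_op_well_defined \<mu> f \<longleftrightarrow>
     (\<forall>n. summable (hankel_term \<mu> f n)) \<and>
     (\<forall>z\<in>unit_disc. summable (\<lambda>n. hankel_coeff \<mu> f n * z ^ n)) \<and>
     hankel_op \<mu> f holomorphic_on unit_disc"

text \<open>Linearity is required on the disc only, the elements of the space being functions there.\<close>

definition besov_bounded_operator ::
  "real \<Rightarrow> ((complex \<Rightarrow> complex) \<Rightarrow> complex \<Rightarrow> complex) \<Rightarrow> bool" where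
  "besov_bounded_operator p T \<longleftrightarrow>
     (\<forall>f\<in>besov_space p. T f \<in> besov_space p) \<and>
     (\<forall>f\<in>besov_space p. \<forall>g\<in>besov_space p. \<forall>a b. \<forall>z\<in>unit_disc.
        T (\<lambda>w. a * f w + b * g w) z = a * T f z + b * T g z) \<and>
     (\<exists>C. \<forall>f\<in>besov_space p. besov_norm p (T f) \<le> C * besov_norm p f)"

end

theory Submission
  imports Defs "HOL-Real_Asymp.Real_Asymp"
begin

text \<open>
  Summing the Taylor series of \<open>f\<close> under the integral sign turns the Hankel operator into the integral
  operator \<open>f \<mapsto> (\<lambda>z. \<integral> f(t) / (1 - t z) d\<mu>(t))\<close>, whose derivative at \<open>z\<close> is
  \<open>\<integral> t f(t) / (1 - t z)\<^sup>2 d\<mu>(t)\<close>. No cancellation has to be exploited: it is enough to estimate this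
  integral with absolute values inside, provided that the growth of \<open>f\<close> along the radius is known
  with the sharp exponent.

  \<^item> A function of the Besov space satisfies \<open>|f(t)| \<le> C \<parallel>f\<parallel> (j + 1) powr (1 - 1/p)\<close> on the dyadic interval
    \<open>[1 - 2\<^sup>-\<^sup>j, 1 - 2\<^sup>-\<^sup>(\<^sup>j\<^sup>+\<^sup>1\<^sup>))\<close> (\<open>besov_growth\<close>). By the sub-mean-value property of \<open>|f'|\<^sup>p\<close>, the increment of \<open>f\<close>
    over one such interval is controlled by the Besov energy of a shell of the disc; the shells
    overlap boundedly, and Hoelder's inequality sums \<open>j + 1\<close> increments.

  \<^item> The Carleson condition gives the interval a \<open>\<mu>\<close>-mass of order \<open>2\<^sup>-\<^sup>j (j + 1) powr (- \<gamma>)\<close>. Hence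
    \<open>|f| d\<mu>\<close> has mass of order \<open>2\<^sup>-\<^sup>j (j + 1) powr (- \<delta>)\<close> there, where \<open>\<delta> = \<gamma> - (1 - 1/p)\<close>. As
    \<open>|1 - t z| \<ge> max (1 - t) (|1 - z| / 2)\<close>, summation over \<open>j\<close> bounds the derivative of the image of
    \<open>f\<close> by a constant times \<open>\<parallel>f\<parallel> 2\<^sup>m (m + 1) powr (- \<delta>)\<close> where \<open>|1 - z| \<ge> 2\<^sup>-\<^sup>m\<close> (\<open>hankel_kernel_bound\<close>).

  \<^item> The weight \<open>(1 - |z|\<^sup>2) powr (p - 2)\<close> has mass of order \<open>\<rho> powr p\<close> on the part of the disc within
    distance \<open>\<rho>\<close> of \<open>1\<close> (\<open>weight_integral_local\<close>). The annulus where \<open>|1 - z|\<close> is comparable to \<open>2\<^sup>-\<^sup>m\<close>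
    therefore contributes at most a constant times \<open>\<parallel>f\<parallel>\<^sup>p (m + 1) powr (- \<delta> p)\<close> to the energy of the
    image (\<open>besov_energy_power_decay\<close>), and these contributions are summable because
    \<open>\<delta> p = 1 + (\<gamma> - 1) p > 1\<close>.
\<close>

section \<open>Sub-mean-value property of powers of holomorphic functions\<close>

text \<open>
  Instead of integrating circular means, maximise \<open>|h(w)| (R - |w - z|) powr (2/p)\<close> over
  the closed disc. Around a maximiser \<open>w0\<close>, at distance \<open>D\<close> from the boundary circle, \<open>|h|\<close> is bounded by
  a multiple of \<open>|h(w0)|\<close>, so Cauchy's estimate for the derivative keeps \<open>|h| \<ge> |h(w0)| / 2\<close> on a disc of
  radius comparable to \<open>D\<close>. The integral over that disc is at least a constant times
  \<open>|h(w0)|\<^sup>p D\<^sup>2\<close>, and this is at least \<open>|h(z)|\<^sup>p R\<^sup>2\<close> by the choice of \<open>w0\<close>: the exponent \<open>2/p\<close> is the one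
  for which the \<open>p\<close>-th power of the maximised function scales like the area.
\<close>

lemma submean_powr:
  fixes p :: real
  assumes p: "p > 0"
  obtains C :: real where "C > 0"
    "\<And>h S z R. \<lbrakk>open S; h holomorphic_on S; cball z R \<subseteq> S; R > 0\<rbrakk> \<Longrightarrow>
       ennreal (cmod (h z) powr p * R\<^sup>2) \<le>
       ennreal C * (\<integral>\<^sup>+w\<in>ball z R. ennreal (cmod (h w) powr p) \<partial>lborel)"
proof -
  define k where "k = 2 / p"
  \<comment> \<open>Makes the variation of h over the disc of radius e D at most half of its value at the centre.\<close>
  define e where "e = 2 powr (-k) / 8"
  have k: "k > 0" "k * p = 2" using p by (auto simp: k_def)
  have e: "e > 0" "e \<le> 1/8"
    using k by (auto simp: e_def powr_minus divide_simps ge_one_powr_ge_zero)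
  define C where "C = 2 powr p / (pi * e\<^sup>2)"
  have "C > 0" using e by (auto simp: C_def)
  moreover have "ennreal (cmod (h z) powr p * R\<^sup>2) \<le>
       ennreal C * (\<integral>\<^sup>+w\<in>ball z R. ennreal (cmod (h w) powr p) \<partial>lborel)"
    if S: "open S" "h holomorphic_on S" "cball z R \<subseteq> S" "R > 0" for h S z R
  proof (cases "h z = 0")
    case True
    then show ?thesis by simp
  next
    case False
    \<comment> \<open>The function F below vanishes on the boundary circle, so its maximum is attained inside.\<close>
    define d where "d w = R - dist z w" for w
    define F where "F w = cmod (h w) * d w powr k" for w
    have cont: "continuous_on (cball z R) h"
      using S holomorphic_on_imp_continuous_on continuous_on_subset by blast
    have "continuous_on (cball z R) F"
      unfolding F_def d_def using k by (intro continuous_intros cont continuous_on_powr') auto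
    then obtain w0 where w0: "w0 \<in> cball z R" and mx: "\<And>w. w \<in> cball z R \<Longrightarrow> F w \<le> F w0"
      using continuous_attains_sup[of "cball z R" F] \<open>R > 0\<close> by force
    have Fz: "F z = cmod (h z) * R powr k" by (simp add: F_def d_def)
    have "F z > 0" using False \<open>R > 0\<close> by (simp add: Fz)
    then have F0: "F w0 > 0" using mx[of z] \<open>R > 0\<close> by force
    have d0: "d w0 > 0"
    proof -
      have "d w0 \<ge> 0" using w0 by (simp add: d_def)
      moreover have "d w0 \<noteq> 0" using F0 by (auto simp: F_def)
      ultimately show ?thesis by simp
    qed
    have h0: "h w0 \<noteq> 0" using F0 by (auto simp: F_def)
    define D where "D = d w0"
    have D: "D > 0" using d0 by (simp add: D_def)
    define B where "B = 2 powr k * cmod (h w0)"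
    have sub: "w \<in> cball z R" "d w \<ge> D/2" if "dist w0 w \<le> D/2" for w
      using that d0 dist_triangle[of z w w0] by (auto simp: d_def D_def)
    have bd: "cmod (h w) \<le> B" if "dist w0 w \<le> D/2" for w
    proof -
      have "cmod (h w) * (D/2) powr k \<le> F w"
        unfolding F_def using sub[OF that] D k by (intro mult_left_mono powr_mono2) auto
      also have "\<dots> \<le> cmod (h w0) * D powr k" using mx[OF sub(1)[OF that]] by (simp add: F_def D_def)
      finally show ?thesis using D by (simp add: powr_divide B_def field_simps)
    qed
    have der: "cmod (deriv h w) \<le> 4 * B / D" if "dist w0 w \<le> D/4" for w
    proof -
      have in2: "dist w0 x \<le> D/2" if "dist w x \<le> D/4" for x
        using that \<open>dist w0 w \<le> D/4\<close> dist_triangle[of w0 x w] by auto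
      have ss: "cball w (D/4) \<subseteq> S" using in2 sub(1) S(3) by (auto simp: subset_iff)
      have "cmod ((deriv ^^ 1) h w) \<le> fact 1 * B / (D/4)^1"
      proof (rule Cauchy_inequality)
        show "h holomorphic_on ball w (D/4)"
          by (rule holomorphic_on_subset[OF S(2)]) (use ss ball_subset_cball in blast)
        show "continuous_on (cball w (D/4)) h"
          using S ss holomorphic_on_imp_continuous_on continuous_on_subset by blast
        show "\<And>x. cmod (w - x) = D / 4 \<Longrightarrow> cmod (h x) \<le> B"
          by (rule bd, rule in2) (simp add: dist_norm)
      qed (use D in simp)
      then show ?thesis by (simp add: mult.commute)
    qed
    have low: "cmod (h w) \<ge> cmod (h w0) / 2" if w: "dist w0 w < e * D" for w
    proof -
      have eD: "e * D \<le> D/4" using mult_right_mono[OF e(2), of D] D by simp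
      have w4: "dist w0 w \<le> D/4" using w eD by linarith
      have "cmod (h w - h w0) \<le> (4 * B / D) * cmod (w - w0)"
      proof (rule field_differentiable_bound[where S = "cball w0 (D/4)" and f' = "deriv h"])
        fix u assume u: "u \<in> cball w0 (D/4)"
        have "u \<in> S" using u sub(1)[of u] D S(3) by auto
        then show "(h has_field_derivative deriv h u) (at u within cball w0 (D/4))"
          using S(1,2) holomorphic_derivI by blast
        show "cmod (deriv h u) \<le> 4 * B / D" using der u by simp
      qed (use w4 D in auto)
      also have "\<dots> \<le> (4 * B / D) * (e * D)"
        using w D by (intro mult_left_mono) (auto simp: dist_norm norm_minus_commute B_def)
      also have "\<dots> = cmod (h w0) / 2"
        using D by (simp add: B_def e_def powr_minus field_simps)
      finally show ?thesis using norm_triangle_ineq2[of "h w0" "h w"] by (simp add: norm_minus_commute)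
    qed
    have sb: "ball w0 (e * D) \<subseteq> ball z R"
    proof
      fix x assume "x \<in> ball w0 (e * D)"
      moreover have "e * D < D" using e D by simp
      ultimately show "x \<in> ball z R" using dist_triangle[of z x w0] by (auto simp: D_def d_def)
    qed
    \<comment> \<open>The exponent k satisfies k p = 2, so that the p-th power of F carries the area factor.\<close>
    have "cmod (h z) powr p * R\<^sup>2 = F z powr p"
      using \<open>R > 0\<close> k by (simp add: Fz powr_mult powr_powr)
    also have "\<dots> \<le> F w0 powr p" using mx[of z] \<open>R > 0\<close> \<open>F z > 0\<close> p by (intro powr_mono2) auto
    also have "\<dots> = cmod (h w0) powr p * D\<^sup>2"
      using D k by (simp add: F_def powr_mult powr_powr flip: D_def)
    also have "\<dots> = C * ((cmod (h w0) / 2) powr p * (pi * (e * D)\<^sup>2))"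
      using e by (simp add: C_def powr_divide power_mult_distrib)
    finally have "ennreal (cmod (h z) powr p * R\<^sup>2)
        \<le> ennreal (C * ((cmod (h w0) / 2) powr p * (pi * (e * D)\<^sup>2)))"
      by (rule ennreal_leI)
    also have "\<dots> = ennreal C * (\<integral>\<^sup>+w. ennreal ((cmod (h w0) / 2) powr p) * indicator (ball w0 (e*D)) w \<partial>lborel)"
      using \<open>C > 0\<close> e D
      by (simp add: nn_integral_cmult_indicator emeasure_ball unit_ball_vol_2 ennreal_mult)
    also have "\<dots> \<le> ennreal C * (\<integral>\<^sup>+w\<in>ball z R. ennreal (cmod (h w) powr p) \<partial>lborel)"
      using low sb p
      by (intro mult_left_mono nn_integral_mono)
         (auto split: split_indicator intro!: ennreal_leI powr_mono2)
    finally show ?thesis .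
  qed
  ultimately show ?thesis using that by blast
qed

section \<open>The Besov weight near a boundary point\<close>

lemma measurable_Complex: "(\<lambda>(x, y). Complex x y) \<in> borel_measurable (lborel \<Otimes>\<^sub>M lborel)"
proof -
  have "(\<lambda>(x, y). Complex x y) = (\<lambda>v. of_real (fst v) + \<i> * of_real (snd v))"
    by (auto simp: fun_eq_iff complex_eq_iff)
  then show ?thesis by simp
qed

lemma lborel_complex: "lborel = distr (lborel \<Otimes>\<^sub>M lborel) borel (\<lambda>(x, y). Complex x y)"
proof (rule lborel_eqI)
  fix l u :: complex
  assume lu: "\<And>b. b \<in> Basis \<Longrightarrow> l \<bullet> b \<le> u \<bullet> b"
  have le: "Re l \<le> Re u" "Im l \<le> Im u"
    using lu[of 1] lu[of \<i>] by (auto simp: Basis_complex_def)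
  have "(\<lambda>(x, y). Complex x y) -` box l u \<inter> space (lborel \<Otimes>\<^sub>M lborel)
      = {Re l<..<Re u} \<times> {Im l<..<Im u}"
    by (auto simp: in_box_complex_iff space_pair_measure)
  then show "emeasure (distr (lborel \<Otimes>\<^sub>M lborel) borel (\<lambda>(x, y). Complex x y)) (box l u) =
      ennreal (\<Prod>b\<in>Basis. (u - l) \<bullet> b)"
    using le measurable_Complex
    by (simp add: emeasure_distr lborel.emeasure_pair_measure_Times ennreal_mult[symmetric]
        Basis_complex_def)
qed simp

lemma nn_integral_complex_slices:
  fixes F :: "complex \<Rightarrow> ennreal"
  assumes [measurable]: "F \<in> borel_measurable borel"
  shows "(\<integral>\<^sup>+z. F z \<partial>lborel) = (\<integral>\<^sup>+y. (\<integral>\<^sup>+x. F (Complex x y) \<partial>lborel) \<partial>lborel)"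
proof -
  note [measurable] = measurable_Complex
  have "(\<integral>\<^sup>+z. F z \<partial>lborel) = (\<integral>\<^sup>+v. F (case v of (x, y) \<Rightarrow> Complex x y) \<partial>(lborel \<Otimes>\<^sub>M lborel))"
    by (subst lborel_complex, subst nn_integral_distr) auto
  also have "\<dots> = (\<integral>\<^sup>+y. (\<integral>\<^sup>+x. F (Complex x y) \<partial>lborel) \<partial>lborel)"
    by (subst lborel_pair.nn_integral_snd[symmetric]) auto
  finally show ?thesis .
qed

lemma nn_integral_powr_left:
  fixes b c \<sigma> :: real
  assumes "\<sigma> > -1" "c \<ge> 0"
  shows "(\<integral>\<^sup>+x. ennreal (indicator {b-c..b} x * (b - x) powr \<sigma>) \<partial>lborel) =
           ennreal (c powr (\<sigma> + 1) / (\<sigma> + 1))"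
proof -
  have "(\<integral>\<^sup>+x. ennreal (indicator {b-c..b} x * (b - x) powr \<sigma>) \<partial>lborel) =
        (\<integral>\<^sup>+x. ennreal (indicator {0..c} x * x powr \<sigma>) \<partial>lborel)"
    by (subst nn_integral_real_affine[where c = "-1" and t = b])
       (auto intro!: nn_integral_cong split: split_indicator)
  also have "\<dots> = ennreal (c powr (\<sigma> + 1) / (\<sigma> + 1))"
    by (rule nn_integral_has_integral_lebesgue[OF _ has_integral_powr_from_0]) (use assms in auto)
  finally show ?thesis .
qed

lemma nn_integral_powr_right:
  fixes b c \<sigma> :: real
  assumes "\<sigma> > -1" "c \<ge> 0"
  shows "(\<integral>\<^sup>+x. ennreal (indicator {b..b+c} x * (x - b) powr \<sigma>) \<partial>lborel) =
           ennreal (c powr (\<sigma> + 1) / (\<sigma> + 1))"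
proof -
  have "(\<integral>\<^sup>+x. ennreal (indicator {b..b+c} x * (x - b) powr \<sigma>) \<partial>lborel) =
        (\<integral>\<^sup>+x. ennreal (indicator {0..c} x * x powr \<sigma>) \<partial>lborel)"
    by (subst nn_integral_real_affine[where c = "1" and t = b])
       (auto intro!: nn_integral_cong split: split_indicator)
  also have "\<dots> = ennreal (c powr (\<sigma> + 1) / (\<sigma> + 1))"
    by (rule nn_integral_has_integral_lebesgue[OF _ has_integral_powr_from_0]) (use assms in auto)
  finally show ?thesis .
qed

lemma one_minus_cmod_Complex:
  fixes x y :: real
  assumes "cmod (Complex x y) < 1"
  defines "b \<equiv> sqrt (1 - y\<^sup>2)"
  shows "\<bar>y\<bar> < 1" "\<bar>x\<bar> < b" "b \<le> 1" "1 - (cmod (Complex x y))\<^sup>2 = (b - \<bar>x\<bar>) * (b + \<bar>x\<bar>)"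
proof -
  have *: "x\<^sup>2 + y\<^sup>2 < 1" using assms(1) by (simp add: cmod_def)
  then have "y\<^sup>2 < 1" using zero_le_power2[of x] by linarith
  then show "\<bar>y\<bar> < 1" by (simp add: abs_square_less_1)
  have b2: "b\<^sup>2 = 1 - y\<^sup>2" using \<open>y\<^sup>2 < 1\<close> by (simp add: b_def)
  show "\<bar>x\<bar> < b" unfolding b_def using * by (intro real_less_rsqrt) auto
  show "b \<le> 1" by (simp add: b_def)
  show "1 - (cmod (Complex x y))\<^sup>2 = (b - \<bar>x\<bar>) * (b + \<bar>x\<bar>)"
    using b2 cmod_power2[of "Complex x y"] by (simp add: algebra_simps power2_eq_square)
qed

text \<open>
  Integrate along horizontal lines. With \<open>b = sqrt (1 - y\<^sup>2)\<close> the weight is \<open>(b - x) powr \<sigma> * (b + x) powr \<sigma>\<close>;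
  close to \<open>1\<close> the second factor is bounded, and the first has an integrable singularity at \<open>x = b\<close>
  because \<open>\<sigma> > -1\<close>.
\<close>

lemma weight_integral_near_one:
  fixes \<sigma> \<rho> :: real
  assumes \<sigma>: "-1 < \<sigma>" "\<sigma> \<le> 0" and \<rho>: "0 < \<rho>" "\<rho> \<le> 1/2"
  shows "(\<integral>\<^sup>+z\<in>ball 0 1 \<inter> ball 1 \<rho>. ennreal ((1 - (cmod z)\<^sup>2) powr \<sigma>) \<partial>lborel)
           \<le> ennreal ((1/2) powr \<sigma> * 2 / (\<sigma> + 1) * \<rho> powr (\<sigma> + 2))"
proof -
  let ?K = "(1/2) powr \<sigma> :: real"
  let ?b = "\<lambda>y::real. sqrt (1 - y\<^sup>2)"
  have pt: "ennreal ((1 - (cmod (Complex x y))\<^sup>2) powr \<sigma>) * indicator (ball 0 1 \<inter> ball 1 \<rho>) (Complex x y)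
      \<le> ennreal ?K * indicator {-\<rho>..\<rho>} y * ennreal (indicator {?b y - \<rho>..?b y} x * (?b y - x) powr \<sigma>)" for x y
  proof (cases "Complex x y \<in> ball 0 1 \<inter> ball 1 \<rho>")
    case True
    let ?z = "Complex x y"
    have z: "cmod ?z < 1" and r: "cmod (1 - ?z) < \<rho>" using True by (auto simp: dist_norm)
    note * = one_minus_cmod_Complex[OF z]
    have xr: "\<bar>1 - x\<bar> < \<rho>" using abs_Re_le_cmod[of "1 - ?z"] r by simp
    have yr: "\<bar>y\<bar> < \<rho>" using abs_Im_le_cmod[of "1 - ?z"] r by simp
    have x: "x > 1/2" using xr \<rho> by linarith
    have "(1 - (cmod ?z)\<^sup>2) powr \<sigma> = (?b y - x) powr \<sigma> * (?b y + x) powr \<sigma>"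
      using * x by (simp add: powr_mult)
    also have "\<dots> \<le> (?b y - x) powr \<sigma> * ?K"
      using * x \<sigma> by (intro mult_left_mono powr_mono2') auto
    finally have "ennreal ((1 - (cmod ?z)\<^sup>2) powr \<sigma>) \<le> ennreal (?K * (?b y - x) powr \<sigma>)"
      by (intro ennreal_leI) (simp add: mult.commute)
    moreover have "?b y - \<rho> \<le> x" using *(3) xr by linarith
    ultimately show ?thesis using True * yr x by (auto simp: ennreal_mult split: split_indicator)
  qed auto
  have "(\<integral>\<^sup>+z\<in>ball 0 1 \<inter> ball 1 \<rho>. ennreal ((1 - (cmod z)\<^sup>2) powr \<sigma>) \<partial>lborel)
     = (\<integral>\<^sup>+y. (\<integral>\<^sup>+x. ennreal ((1 - (cmod (Complex x y))\<^sup>2) powr \<sigma>) *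
          indicator (ball 0 1 \<inter> ball 1 \<rho>) (Complex x y) \<partial>lborel) \<partial>lborel)"
    by (intro nn_integral_complex_slices borel_measurable_times_ennreal borel_measurable_indicator) auto
  also have "\<dots> \<le> (\<integral>\<^sup>+y. (\<integral>\<^sup>+x. ennreal ?K * indicator {-\<rho>..\<rho>} y *
       ennreal (indicator {?b y - \<rho>..?b y} x * (?b y - x) powr \<sigma>) \<partial>lborel) \<partial>lborel)"
    by (intro nn_integral_mono pt)
  also have "\<dots> = (\<integral>\<^sup>+y. ennreal ?K * indicator {-\<rho>..\<rho>} y * ennreal (\<rho> powr (\<sigma> + 1) / (\<sigma> + 1)) \<partial>lborel)"
    using \<sigma> \<rho> by (subst nn_integral_cmult) (auto simp: nn_integral_powr_left)
  also have "\<dots> = (\<integral>\<^sup>+y. ennreal (?K * (\<rho> powr (\<sigma> + 1) / (\<sigma> + 1))) * indicator {-\<rho>..\<rho>} y \<partial>lborel)"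
    using \<sigma> by (subst ennreal_mult) (auto simp: mult_ac)
  also have "\<dots> = ennreal (?K * (\<rho> powr (\<sigma> + 1) / (\<sigma> + 1))) * emeasure lborel {-\<rho>..\<rho>}"
    by (rule nn_integral_cmult_indicator) simp
  also have "emeasure lborel {-\<rho>..\<rho>} = ennreal (2 * \<rho>)"
    using \<rho> by (subst emeasure_lborel_Icc) auto
  also have "ennreal (?K * (\<rho> powr (\<sigma> + 1) / (\<sigma> + 1))) * ennreal (2 * \<rho>)
      = ennreal (?K * (\<rho> powr (\<sigma> + 1) / (\<sigma> + 1)) * (2 * \<rho>))"
    using \<rho> \<sigma> by (intro ennreal_mult[symmetric]) auto
  also have "?K * (\<rho> powr (\<sigma> + 1) / (\<sigma> + 1)) * (2 * \<rho>) = ?K * 2 / (\<sigma> + 1) * (\<rho> powr (\<sigma> + 1) * \<rho> powr 1)"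
    using \<rho> by simp
  also have "\<rho> powr (\<sigma> + 1) * \<rho> powr 1 = \<rho> powr (\<sigma> + 2)"
    by (simp only: powr_add[symmetric]) (simp add: add.commute)
  finally show ?thesis .
qed

text \<open>
  On the line at height \<open>y\<close> both end points \<open>\<plusminus>b\<close> are singular, and the integral along it is of order
  \<open>b powr (2 \<sigma> + 1)\<close>. This is at most \<open>(1 - \<bar>y\<bar>) powr (-1/2)\<close>, which is integrable.
\<close>

lemma weight_integral_disc:
  fixes \<sigma> :: real
  assumes \<sigma>: "-1 < \<sigma>" "\<sigma> \<le> 0"
  shows "(\<integral>\<^sup>+z\<in>ball 0 1. ennreal ((1 - (cmod z)\<^sup>2) powr \<sigma>) \<partial>lborel) \<le> ennreal (8 / (\<sigma> + 1))"
proof -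
  let ?b = "\<lambda>y::real. sqrt (1 - y\<^sup>2)"
  let ?L = "\<lambda>\<tau> b x::real. ennreal (indicator {b-b..b} x * (b - x) powr \<tau>)"
  let ?R = "\<lambda>\<tau> b x::real. ennreal (indicator {-b..-b+b} x * (x - (-b)) powr \<tau>)"
  have LR: "(\<integral>\<^sup>+x. (?L \<tau> b x + ?R \<tau> b x) \<partial>lborel) = ennreal (2 * (b powr (\<tau> + 1) / (\<tau> + 1)))"
    if "\<tau> > -1" "b \<ge> 0" for \<tau> b
  proof -
    have "(\<integral>\<^sup>+x. (?L \<tau> b x + ?R \<tau> b x) \<partial>lborel) = (\<integral>\<^sup>+x. ?L \<tau> b x \<partial>lborel) + (\<integral>\<^sup>+x. ?R \<tau> b x \<partial>lborel)"
      by (rule nn_integral_add) auto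
    also have "\<dots> = ennreal (b powr (\<tau> + 1) / (\<tau> + 1)) + ennreal (b powr (\<tau> + 1) / (\<tau> + 1))"
      using that by (simp only: nn_integral_powr_left nn_integral_powr_right)
    finally show ?thesis using that by (simp add: ennreal_plus[symmetric] del: ennreal_plus)
  qed
  have pt: "ennreal ((1 - (cmod (Complex x y))\<^sup>2) powr \<sigma>) * indicator (ball 0 1) (Complex x y)
      \<le> indicator {-1..1} y * (ennreal (?b y powr \<sigma>) * (?L \<sigma> (?b y) x + ?R \<sigma> (?b y) x))" for x y
  proof (cases "Complex x y \<in> ball 0 1")
    case True
    let ?z = "Complex x y"
    have z: "cmod ?z < 1" using True by (auto simp: dist_norm)
    note * = one_minus_cmod_Complex[OF z]
    have "(1 - (cmod ?z)\<^sup>2) powr \<sigma> = (?b y - \<bar>x\<bar>) powr \<sigma> * (?b y + \<bar>x\<bar>) powr \<sigma>"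
      using * by (simp add: powr_mult)
    also have "\<dots> \<le> (?b y - \<bar>x\<bar>) powr \<sigma> * ?b y powr \<sigma>"
      using * \<sigma> by (intro mult_left_mono powr_mono2') (auto simp: abs_square_less_1)
    finally have "ennreal ((1 - (cmod ?z)\<^sup>2) powr \<sigma>) \<le> ennreal (?b y powr \<sigma> * (?b y - \<bar>x\<bar>) powr \<sigma>)"
      by (intro ennreal_leI) (simp add: mult.commute)
    also have "\<dots> = ennreal (?b y powr \<sigma>) * ennreal ((?b y - \<bar>x\<bar>) powr \<sigma>)"
      by (simp add: ennreal_mult)
    finally have "ennreal ((1 - (cmod ?z)\<^sup>2) powr \<sigma>)
        \<le> ennreal (?b y powr \<sigma>) * ennreal ((?b y - \<bar>x\<bar>) powr \<sigma>)" .
    moreover have "ennreal ((?b y - \<bar>x\<bar>) powr \<sigma>) \<le> ?L \<sigma> (?b y) x + ?R \<sigma> (?b y) x"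
    proof (cases "x \<ge> 0")
      case True
      then have "ennreal ((?b y - \<bar>x\<bar>) powr \<sigma>) = ?L \<sigma> (?b y) x" using *(2) by simp
      then show ?thesis by simp
    next
      case False
      then have "ennreal ((?b y - \<bar>x\<bar>) powr \<sigma>) = ?R \<sigma> (?b y) x" using *(2) by (simp add: add.commute)
      then show ?thesis by simp
    qed
    moreover have "y \<in> {-1..1}" using *(1) by auto
    ultimately show ?thesis using True order_trans mult_left_mono by fastforce
  qed auto
  have pt2: "indicator {-1..1} y * (ennreal (?b y powr \<sigma>) * ennreal (2 * (?b y powr (\<sigma> + 1) / (\<sigma> + 1))))
     \<le> ennreal (2 / (\<sigma> + 1)) * (?L (-1/2) 1 y + ?R (-1/2) 1 y)" for y
  proof (cases "\<bar>y\<bar> < 1")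
    case True
    have y2: "y\<^sup>2 \<le> \<bar>y\<bar>" using True mult_left_le[of "\<bar>y\<bar>" "\<bar>y\<bar>"] by (simp add: power2_eq_square)
    have b: "?b y > 0" "?b y \<le> 1" using True by (auto simp: abs_square_less_1)
    have "?b y powr \<sigma> * ?b y powr (\<sigma> + 1) = ?b y powr (2 * \<sigma> + 1)"
      by (simp add: powr_add[symmetric])
    also have "\<dots> \<le> ?b y powr (-1)" using b \<sigma> by (intro powr_mono') auto
    also have "\<dots> = (1 - y\<^sup>2) powr (-1/2)"
      using b by (simp add: powr_half_sqrt[symmetric] powr_powr powr_minus_divide)
    also have "\<dots> \<le> (1 - \<bar>y\<bar>) powr (-1/2)"
      using True y2 by (intro powr_mono2') auto
    finally have "?b y powr \<sigma> * ?b y powr (\<sigma> + 1) \<le> (1 - \<bar>y\<bar>) powr (-1/2)" .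
    from mult_left_mono[OF this, of "2 / (\<sigma> + 1)"]
    have "ennreal (?b y powr \<sigma> * (2 * (?b y powr (\<sigma> + 1) / (\<sigma> + 1))))
       \<le> ennreal (2 / (\<sigma> + 1) * (1 - \<bar>y\<bar>) powr (-1/2))"
      using \<sigma> by (intro ennreal_leI) (simp add: mult_ac)
    also have "\<dots> = ennreal (2 / (\<sigma> + 1)) * ennreal ((1 - \<bar>y\<bar>) powr (-1/2))"
      using \<sigma> by (subst ennreal_mult[symmetric]) auto
    finally have ub: "ennreal (?b y powr \<sigma> * (2 * (?b y powr (\<sigma> + 1) / (\<sigma> + 1))))
      \<le> ennreal (2 / (\<sigma> + 1)) * ennreal ((1 - \<bar>y\<bar>) powr (-1/2))" .
    have "ennreal ((1 - \<bar>y\<bar>) powr (-1/2)) \<le> ?L (-1/2) 1 y + ?R (-1/2) 1 y"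
    proof (cases "y \<ge> 0")
      case True
      then have "ennreal ((1 - \<bar>y\<bar>) powr (-1/2)) = ?L (-1/2) 1 y" using \<open>\<bar>y\<bar> < 1\<close> by simp
      then show ?thesis by simp
    next
      case False
      then have "ennreal ((1 - \<bar>y\<bar>) powr (-1/2)) = ?R (-1/2) 1 y" using \<open>\<bar>y\<bar> < 1\<close> by (simp add: add.commute)
      then show ?thesis by simp
    qed
    from order_trans[OF ub mult_left_mono[OF this]]
    have "ennreal (?b y powr \<sigma>) * ennreal (2 * (?b y powr (\<sigma> + 1) / (\<sigma> + 1)))
      \<le> ennreal (2 / (\<sigma> + 1)) * (?L (-1/2) 1 y + ?R (-1/2) 1 y)"
      using \<sigma> by (subst ennreal_mult[symmetric]) auto
    moreover have "y \<in> {-1..1}" using True by auto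
    ultimately show ?thesis by simp
  next
    case False
    then consider "y = 1 \<or> y = -1" | "y \<notin> {-1..1}" by force
    then show ?thesis by cases auto
  qed
  have "(\<integral>\<^sup>+z\<in>ball 0 1. ennreal ((1 - (cmod z)\<^sup>2) powr \<sigma>) \<partial>lborel)
     = (\<integral>\<^sup>+y. (\<integral>\<^sup>+x. ennreal ((1 - (cmod (Complex x y))\<^sup>2) powr \<sigma>) *
          indicator (ball 0 1) (Complex x y) \<partial>lborel) \<partial>lborel)"
    by (intro nn_integral_complex_slices borel_measurable_times_ennreal borel_measurable_indicator) auto
  also have "\<dots> \<le> (\<integral>\<^sup>+y. (\<integral>\<^sup>+x. indicator {-1..1} y * (ennreal (?b y powr \<sigma>) *
       (?L \<sigma> (?b y) x + ?R \<sigma> (?b y) x)) \<partial>lborel) \<partial>lborel)"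
    by (intro nn_integral_mono pt)
  also have "\<dots> = (\<integral>\<^sup>+y. indicator {-1..1} y * (ennreal (?b y powr \<sigma>) *
       (\<integral>\<^sup>+x. (?L \<sigma> (?b y) x + ?R \<sigma> (?b y) x) \<partial>lborel)) \<partial>lborel)"
    by (simp add: nn_integral_cmult del: nn_integral_add)
  also have "\<dots> = (\<integral>\<^sup>+y. indicator {-1..1} y * (ennreal (?b y powr \<sigma>) *
       ennreal (2 * (?b y powr (\<sigma> + 1) / (\<sigma> + 1)))) \<partial>lborel)"
  proof (intro nn_integral_cong)
    fix y :: real
    show "indicator {-1..1} y * (ennreal (?b y powr \<sigma>) *
       (\<integral>\<^sup>+x. (?L \<sigma> (?b y) x + ?R \<sigma> (?b y) x) \<partial>lborel)) = indicator {-1..1} y * (ennreal (?b y powr \<sigma>) *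
       ennreal (2 * (?b y powr (\<sigma> + 1) / (\<sigma> + 1))))"
    proof (cases "y \<in> {-1..1}")
      case True
      then have "?b y \<ge> 0" by (simp add: abs_square_le_1 abs_le_iff)
      from LR[OF \<sigma>(1) this] show ?thesis by (simp only:)
    qed simp
  qed
  also have "\<dots> \<le> (\<integral>\<^sup>+y. ennreal (2 / (\<sigma> + 1)) * (?L (-1/2) 1 y + ?R (-1/2) 1 y) \<partial>lborel)"
    by (intro nn_integral_mono pt2)
  also have "\<dots> = ennreal (2 / (\<sigma> + 1)) * (\<integral>\<^sup>+y. (?L (-1/2) 1 y + ?R (-1/2) 1 y) \<partial>lborel)"
    by (rule nn_integral_cmult) auto
  also have "(\<integral>\<^sup>+y. (?L (-1/2) 1 y + ?R (-1/2) 1 y) \<partial>lborel) = ennreal 4"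
    by (subst LR) auto
  also have "ennreal (2 / (\<sigma> + 1)) * ennreal 4 = ennreal (8 / (\<sigma> + 1))"
    using \<sigma> by (subst ennreal_mult[symmetric]) auto
  finally show ?thesis .
qed

text \<open>
  Scaling predicts \<open>\<rho> powr (\<sigma> + 2)\<close>: two dimensions of area and a weight of homogeneity \<open>\<sigma>\<close> in the
  distance to the boundary. For \<open>\<sigma> > 0\<close> the weight itself is at most \<open>(2 \<rho>) powr \<sigma>\<close>. Radii above \<open>1/2\<close> are
  covered by the integral over the whole disc.
\<close>

lemma weight_integral_local:
  fixes \<sigma> :: real
  assumes \<sigma>: "-1 < \<sigma>"
  obtains C where "C > 0" "\<And>\<rho>. 0 < \<rho> \<Longrightarrow> \<rho> \<le> 2 \<Longrightarrow>
    (\<integral>\<^sup>+z\<in>ball 0 1 \<inter> ball 1 \<rho>. ennreal ((1 - (cmod z)\<^sup>2) powr \<sigma>) \<partial>lborel) \<le> ennreal (C * \<rho> powr (\<sigma> + 2))"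
proof (cases "\<sigma> \<le> 0")
  case True
  define C1 where "C1 = (1/2) powr \<sigma> * 2 / (\<sigma> + 1)"
  define C2 where "C2 = 8 / (\<sigma> + 1) * 2 powr (\<sigma> + 2)"
  have C: "C1 > 0" "C2 > 0" using \<sigma> by (auto simp: C1_def C2_def)
  show ?thesis
  proof (rule that[of "C1 + C2"])
    show "C1 + C2 > 0" using C by simp
    fix \<rho> :: real assume \<rho>: "0 < \<rho>" "\<rho> \<le> 2"
    let ?I = "(\<integral>\<^sup>+z\<in>ball 0 1 \<inter> ball 1 \<rho>. ennreal ((1 - (cmod z)\<^sup>2) powr \<sigma>) \<partial>lborel)"
    show "?I \<le> ennreal ((C1 + C2) * \<rho> powr (\<sigma> + 2))"
    proof (cases "\<rho> \<le> 1/2")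
      case le: True
      have "?I \<le> ennreal (C1 * \<rho> powr (\<sigma> + 2))"
        unfolding C1_def using weight_integral_near_one[OF \<sigma> True \<rho>(1) le] .
      also have "\<dots> \<le> ennreal ((C1 + C2) * \<rho> powr (\<sigma> + 2))"
        using C by (intro ennreal_leI mult_right_mono) auto
      finally show ?thesis .
    next
      case False
      have "?I \<le> (\<integral>\<^sup>+z\<in>ball 0 1. ennreal ((1 - (cmod z)\<^sup>2) powr \<sigma>) \<partial>lborel)"
        by (intro nn_integral_mono) (auto split: split_indicator)
      also have "\<dots> \<le> ennreal (8 / (\<sigma> + 1))" by (rule weight_integral_disc[OF \<sigma> True])
      also have "\<dots> \<le> ennreal (C2 * \<rho> powr (\<sigma> + 2))"
      proof (rule ennreal_leI)
        have "(1/2) powr (\<sigma> + 2) \<le> \<rho> powr (\<sigma> + 2)" using False \<sigma> by (intro powr_mono2) auto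
        then have "C2 * (1/2) powr (\<sigma> + 2) \<le> C2 * \<rho> powr (\<sigma> + 2)" using C by simp
        moreover have "C2 * (1/2) powr (\<sigma> + 2) = 8 / (\<sigma> + 1)"
          unfolding C2_def by (simp add: powr_mult[symmetric])
        ultimately show "8 / (\<sigma> + 1) \<le> C2 * \<rho> powr (\<sigma> + 2)" by simp
      qed
      also have "\<dots> \<le> ennreal ((C1 + C2) * \<rho> powr (\<sigma> + 2))"
        using C by (intro ennreal_leI mult_right_mono) auto
      finally show ?thesis .
    qed
  qed
next
  case False
  show ?thesis
  proof (rule that[of "2 powr \<sigma> * pi"])
    fix \<rho> :: real assume \<rho>: "0 < \<rho>" "\<rho> \<le> 2"
    have pt: "(1 - (cmod z)\<^sup>2) powr \<sigma> \<le> (2 * \<rho>) powr \<sigma>" if "cmod z < 1" "cmod (1 - z) < \<rho>" for z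
    proof (rule powr_mono2)
      have "1 - cmod z \<le> cmod (1 - z)" using norm_triangle_ineq2[of 1 z] by simp
      moreover have "1 - (cmod z)\<^sup>2 = (1 - cmod z) * (1 + cmod z)" by (simp add: algebra_simps power2_eq_square)
      moreover have "(1 - cmod z) * (1 + cmod z) \<le> (1 - cmod z) * 2"
        using that by (intro mult_left_mono) auto
      moreover have "(1 - cmod z) * 2 \<le> 2 * \<rho>" using that calculation(1) by simp
      ultimately show "1 - (cmod z)\<^sup>2 \<le> 2 * \<rho>" by simp
      show "0 \<le> 1 - (cmod z)\<^sup>2" using that by (simp add: power_le_one)
    qed (use False in simp)
    have "(\<integral>\<^sup>+z\<in>ball 0 1 \<inter> ball 1 \<rho>. ennreal ((1 - (cmod z)\<^sup>2) powr \<sigma>) \<partial>lborel)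
       \<le> (\<integral>\<^sup>+z. ennreal ((2 * \<rho>) powr \<sigma>) * indicator (ball 1 \<rho>) z \<partial>(lborel :: complex measure))"
      using pt by (intro nn_integral_mono) (auto simp: dist_norm intro!: ennreal_leI split: split_indicator)
    also have "\<dots> = ennreal ((2 * \<rho>) powr \<sigma> * (pi * \<rho>\<^sup>2))"
      using \<rho> by (simp add: nn_integral_cmult_indicator emeasure_ball unit_ball_vol_2 ennreal_mult)
    also have "(2 * \<rho>) powr \<sigma> * (pi * \<rho>\<^sup>2) = 2 powr \<sigma> * pi * \<rho> powr (\<sigma> + 2)"
      using \<rho> by (simp add: powr_mult powr_add)
    finally show "(\<integral>\<^sup>+z\<in>ball 0 1 \<inter> ball 1 \<rho>. ennreal ((1 - (cmod z)\<^sup>2) powr \<sigma>) \<partial>lborel)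
       \<le> ennreal (2 powr \<sigma> * pi * \<rho> powr (\<sigma> + 2))" .
  qed simp
qed

section \<open>Besov energy and growth of Besov functions\<close>

lemma besov_integrand_nonneg: "besov_integrand p f z \<ge> 0"
  by (simp add: besov_integrand_def)

lemma borel_measurable_besov_integrand:
  assumes "f holomorphic_on unit_disc" "p > 0"
  shows "besov_integrand p f \<in> borel_measurable (restrict_space lborel unit_disc)"
proof -
  have "continuous_on unit_disc (deriv f)"
    using assms by (intro holomorphic_on_imp_continuous_on holomorphic_deriv) auto
  then have "continuous_on unit_disc (besov_integrand p f)"
    unfolding besov_integrand_def using assms(2)
    by (intro continuous_intros continuous_on_powr') (auto simp: abs_square_eq_1)
  then have "besov_integrand p f \<in> borel_measurable (restrict_space borel unit_disc)"
    by (rule borel_measurable_continuous_on_restrict)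
  then show ?thesis
    by (simp add: measurable_def space_restrict_space sets_restrict_space)
qed

lemma borel_measurable_besov_indicator:
  assumes "f holomorphic_on unit_disc" "p > 0" "A \<subseteq> unit_disc" "A \<in> sets borel"
  shows "(\<lambda>z. ennreal (besov_integrand p f z) * indicator A z) \<in> borel_measurable lborel"
proof -
  have "(\<lambda>z. ennreal (besov_integrand p f z)) \<in> borel_measurable (restrict_space lborel unit_disc)"
    using borel_measurable_besov_integrand[OF assms(1,2)] by measurable
  then have [measurable]: "(\<lambda>z. ennreal (besov_integrand p f z) * indicator unit_disc z) \<in> borel_measurable lborel"
    by (subst (asm) borel_measurable_restrict_space_iff_ennreal) auto
  have "(\<lambda>z. ennreal (besov_integrand p f z) * indicator A z) =
    (\<lambda>z. ennreal (besov_integrand p f z) * indicator unit_disc z * indicator A z)"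
    using assms(3) by (auto simp: fun_eq_iff split: split_indicator)
  then show ?thesis using assms(4) by (simp add: borel_measurable_times_ennreal)
qed

text \<open>
  Lebesgue measure is used here without the factor \<open>1/\<pi>\<close> of the normalised area measure; the values
  are extended so that energies can be compared and summed before they are known to be finite.
\<close>

definition besov_energy :: "real \<Rightarrow> (complex \<Rightarrow> complex) \<Rightarrow> complex set \<Rightarrow> ennreal" where
  "besov_energy p f A = (\<integral>\<^sup>+z\<in>A. ennreal (besov_integrand p f z) \<partial>lborel)"

lemma nn_integral_disc_area:
  assumes "f holomorphic_on unit_disc" "p > 0"
  shows "(\<integral>\<^sup>+z. ennreal (besov_integrand p f z) \<partial>disc_area) = ennreal (1 / pi) * besov_energy p f unit_disc"
proof -
  have m: "(\<lambda>z. ennreal (besov_integrand p f z)) \<in> borel_measurable (restrict_space lborel unit_disc)"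
    using borel_measurable_besov_integrand[OF assms] by measurable
  show ?thesis
    unfolding disc_area_def besov_energy_def
    by (subst nn_integral_density) (use m in \<open>auto simp: nn_integral_cmult nn_integral_restrict_space\<close>)
qed

lemma besov_energy_unit_disc:
  assumes "f \<in> besov_space p" "p > 0"
  shows "besov_energy p f unit_disc = ennreal (pi * besov_seminorm p f powr p)"
proof -
  have f: "f holomorphic_on unit_disc" "integrable disc_area (besov_integrand p f)"
    using assms by (auto simp: besov_space_def)
  let ?J = "LINT z|disc_area. besov_integrand p f z"
  have J: "?J \<ge> 0" by (simp add: besov_integrand_nonneg)
  have "ennreal ?J = ennreal (1 / pi) * besov_energy p f unit_disc"
    unfolding nn_integral_disc_area[OF f(1) assms(2), symmetric]
    by (rule nn_integral_eq_integral[symmetric]) (use f besov_integrand_nonneg in auto)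
  then have "ennreal pi * ennreal ?J = (ennreal pi * ennreal (1 / pi)) * besov_energy p f unit_disc"
    by (simp add: mult.assoc)
  also have "ennreal pi * ennreal (1 / pi) = 1"
    by (subst ennreal_mult[symmetric]) auto
  finally show ?thesis
    using J assms(2) by (simp add: besov_seminorm_def powr_powr ennreal_mult)
qed

lemma besov_space_energyI:
  assumes "f holomorphic_on unit_disc" "p > 0" "besov_energy p f unit_disc \<le> ennreal K" "K \<ge> 0"
  shows "f \<in> besov_space p" "besov_seminorm p f powr p \<le> K"
proof -
  have m: "besov_integrand p f \<in> borel_measurable disc_area"
    using borel_measurable_besov_integrand[OF assms(1,2)] by (simp add: disc_area_def)
  have "(\<integral>\<^sup>+z. ennreal (norm (besov_integrand p f z)) \<partial>disc_area)
      = (\<integral>\<^sup>+z. ennreal (besov_integrand p f z) \<partial>disc_area)"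
    by (simp add: besov_integrand_nonneg)
  also have "\<dots> = ennreal (1 / pi) * besov_energy p f unit_disc"
    by (rule nn_integral_disc_area[OF assms(1,2)])
  also have "\<dots> \<le> ennreal (1 / pi) * ennreal K"
    using assms(3) by (rule mult_left_mono) simp
  also have "\<dots> < \<infinity>" by (simp add: ennreal_mult[symmetric] assms(4))
  finally show *: "f \<in> besov_space p"
    using m assms(1) by (auto simp: besov_space_def integrable_iff_bounded)
  have "ennreal (pi * besov_seminorm p f powr p) \<le> ennreal K"
    using besov_energy_unit_disc[OF * assms(2)] assms(3) by simp
  then have "pi * besov_seminorm p f powr p \<le> K" using assms(4) by simp
  moreover have "1 * besov_seminorm p f powr p \<le> pi * besov_seminorm p f powr p"
    using pi_ge_two by (intro mult_right_mono) auto
  ultimately show "besov_seminorm p f powr p \<le> K" by simp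
qed

lemma besov_norm_bounds:
  assumes "p > 0"
  shows "besov_norm p f \<ge> 0" "cmod (f 0) \<le> besov_norm p f"
    "besov_seminorm p f powr p \<le> besov_norm p f powr p"
proof -
  have e: "besov_norm p f powr p = cmod (f 0) powr p + besov_seminorm p f powr p"
    using assms by (simp add: besov_norm_def powr_powr)
  show "besov_norm p f \<ge> 0" by (simp add: besov_norm_def)
  show "besov_seminorm p f powr p \<le> besov_norm p f powr p" unfolding e by simp
  have "cmod (f 0) powr p \<le> besov_norm p f powr p" unfolding e by simp
  then show "cmod (f 0) \<le> besov_norm p f"
    using assms by (metis \<open>0 \<le> besov_norm p f\<close> norm_ge_zero not_le powr_less_mono2)
qed

text \<open>
  On the disc of radius \<open>(1 - |z|) / 2\<close> around \<open>z\<close> the weight \<open>(1 - |w|\<^sup>2) powr (p - 2)\<close> is comparable to its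
  value at the centre, so the sub-mean-value property of \<open>|f'|\<^sup>p\<close> carries over to the Besov energy.
\<close>

lemma besov_local_estimate:
  fixes p :: real
  assumes p: "p > 0"
  obtains C :: real where "C > 0"
    "\<And>f z. \<lbrakk>f holomorphic_on unit_disc; cmod z < 1\<rbrakk> \<Longrightarrow>
       ennreal (((1 - cmod z) * cmod (deriv f z)) powr p) \<le>
       ennreal C * besov_energy p f (ball z ((1 - cmod z) / 2))"
proof -
  obtain C0 where C0: "C0 > 0" and sub:
    "\<And>h S z R. \<lbrakk>open S; h holomorphic_on S; cball z R \<subseteq> S; R > 0\<rbrakk> \<Longrightarrow>
       ennreal (cmod (h z) powr p * R\<^sup>2) \<le>
       ennreal C0 * (\<integral>\<^sup>+w\<in>ball z R. ennreal (cmod (h w) powr p) \<partial>lborel)"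
    using submean_powr[OF p] by blast
  \<comment> \<open>On the disc considered, R \<open>\<le>\<close> 1 - |w|^2 \<open>\<le>\<close> 6 R; which end is the worst depends on the sign of p - 2.\<close>
  define c where "c = min 1 (6 powr (p - 2))"
  have c: "c > 0" by (simp add: c_def)
  define C where "C = 2 powr p * C0 / c"
  have "C > 0" using C0 c by (simp add: C_def)
  moreover have "ennreal (((1 - cmod z) * cmod (deriv f z)) powr p) \<le>
       ennreal C * besov_energy p f (ball z ((1 - cmod z) / 2))"
    if f: "f holomorphic_on unit_disc" and z: "cmod z < 1" for f z
  proof -
    define R where "R = (1 - cmod z) / 2"
    have R: "R > 0" "1 - cmod z = 2 * R" using z by (auto simp: R_def)
    have in_ball: "R \<le> 1 - cmod w" "cmod w < 1" if "dist z w \<le> R" for w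
      using that R norm_triangle_ineq2[of w z] by (auto simp: dist_norm norm_minus_commute)
    have sb: "cball z R \<subseteq> unit_disc" using in_ball by auto
    have df: "deriv f holomorphic_on unit_disc" by (intro holomorphic_deriv f) auto
    have meas: "(\<lambda>w. ennreal (besov_integrand p f w) * indicator (ball z R) w) \<in> borel_measurable lborel"
      by (rule borel_measurable_besov_indicator[OF f p]) (use sb ball_subset_cball in auto)
    have pt: "cmod (deriv f w) powr p \<le> R powr (2 - p) / c * besov_integrand p f w" if w: "dist z w < R" for w
    proof -
      have 1: "R \<le> 1 - (cmod w)\<^sup>2" "1 - (cmod w)\<^sup>2 \<le> 6 * R" "cmod w < 1"
      proof -
        have w1: "R \<le> 1 - cmod w" "cmod w < 1" using in_ball[of w] w by auto
        have w2: "1 - cmod w \<le> 3 * R"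
          using R w norm_triangle_ineq2[of z w] by (auto simp: dist_norm)
        have e: "1 - (cmod w)\<^sup>2 = (1 - cmod w) * (1 + cmod w)" by (simp add: algebra_simps power2_eq_square)
        have "R \<le> (1 - cmod w) * 1" using w1 by simp
        also have "\<dots> \<le> (1 - cmod w) * (1 + cmod w)" using w1 by (intro mult_left_mono) auto
        finally show "R \<le> 1 - (cmod w)\<^sup>2" unfolding e .
        have "(1 - cmod w) * (1 + cmod w) \<le> (3 * R) * 2" using w1 w2 by (intro mult_mono) auto
        then show "1 - (cmod w)\<^sup>2 \<le> 6 * R" unfolding e by simp
        show "cmod w < 1" by fact
      qed
      have "c * R powr (p - 2) \<le> (1 - (cmod w)\<^sup>2) powr (p - 2)"
      proof (cases "p \<ge> 2")
        case True
        have "c * R powr (p - 2) \<le> R powr (p - 2)"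
          using mult_right_mono[of c 1 "R powr (p - 2)"] by (simp add: c_def)
        also have "\<dots> \<le> (1 - (cmod w)\<^sup>2) powr (p - 2)" using True 1 R by (intro powr_mono2) auto
        finally show ?thesis .
      next
        case False
        have "c * R powr (p - 2) \<le> (6 * R) powr (p - 2)"
          using R by (simp add: c_def powr_mult mult_right_mono)
        also have "\<dots> \<le> (1 - (cmod w)\<^sup>2) powr (p - 2)" using False 1 R by (intro powr_mono2') auto
        finally show ?thesis .
      qed
      then have "c * R powr (p - 2) * cmod (deriv f w) powr p \<le> besov_integrand p f w"
        unfolding besov_integrand_def by (rule mult_right_mono) simp
      then have "R powr (2 - p) / c * (c * R powr (p - 2) * cmod (deriv f w) powr p)
          \<le> R powr (2 - p) / c * besov_integrand p f w"
        using c by (intro mult_left_mono) auto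
      moreover have "R powr (2 - p) * R powr (p - 2) = 1"
        using R by (simp add: powr_add[symmetric])
      ultimately show ?thesis using c by (simp add: field_simps)
    qed
    have "ennreal (cmod (deriv f z) powr p * R\<^sup>2)
        \<le> ennreal C0 * (\<integral>\<^sup>+w\<in>ball z R. ennreal (cmod (deriv f w) powr p) \<partial>lborel)"
      by (rule sub[OF _ df sb R(1)]) simp
    also have "\<dots> \<le> ennreal C0 * (\<integral>\<^sup>+w. ennreal (R powr (2 - p) / c) *
         (ennreal (besov_integrand p f w) * indicator (ball z R) w) \<partial>lborel)"
      using pt c by (intro mult_left_mono nn_integral_mono)
         (auto split: split_indicator simp: ennreal_mult[symmetric] besov_integrand_nonneg)
    also have "\<dots> = ennreal C0 * (ennreal (R powr (2 - p) / c) * besov_energy p f (ball z R))"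
      unfolding besov_energy_def by (subst nn_integral_cmult[OF meas]) simp
    finally have main: "ennreal (cmod (deriv f z) powr p * R\<^sup>2)
        \<le> ennreal C0 * (ennreal (R powr (2 - p) / c) * besov_energy p f (ball z R))" .
    have "((1 - cmod z) * cmod (deriv f z)) powr p =
        2 powr p * R powr (p - 2) * (cmod (deriv f z) powr p * R\<^sup>2)"
      using R by (simp add: powr_mult powr_diff)
    then have "ennreal (((1 - cmod z) * cmod (deriv f z)) powr p) =
        ennreal (2 powr p * R powr (p - 2)) * ennreal (cmod (deriv f z) powr p * R\<^sup>2)"
      by (simp add: ennreal_mult)
    also have "\<dots> \<le> ennreal (2 powr p * R powr (p - 2)) *
        (ennreal C0 * (ennreal (R powr (2 - p) / c) * besov_energy p f (ball z R)))"
      using main by (rule mult_left_mono) simp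
    also have "\<dots> = (ennreal (2 powr p * R powr (p - 2)) * ennreal C0 * ennreal (R powr (2 - p) / c))
        * besov_energy p f (ball z R)"
      by (simp only: mult.assoc)
    also have "ennreal (2 powr p * R powr (p - 2)) * ennreal C0 * ennreal (R powr (2 - p) / c) = ennreal C"
    proof -
      have "R powr (p - 2) * R powr (2 - p) = 1"
        using R by (simp add: powr_add[symmetric])
      then have "2 powr p * R powr (p - 2) * C0 * (R powr (2 - p) / c) = C"
        by (simp add: C_def field_simps)
      then show ?thesis using C0 c by (simp add: ennreal_mult[symmetric])
    qed
    finally show ?thesis by (simp add: R_def)
  qed
  ultimately show ?thesis using that by blast
qed

text \<open>
  Hoelder's inequality for sums, up to the factor 2. It follows from
  \<open>B \<le> l + B powr p * l powr (1 - p)\<close>, valid for every level \<open>l > 0\<close>, with the level that balances the two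
  resulting sums.
\<close>

lemma sum_le_powr_sum:
  fixes p S :: real and B :: "nat \<Rightarrow> real"
  assumes p: "p > 1" and B: "\<And>i. B i \<ge> 0" and S: "S \<ge> 0"
    and sum: "(\<Sum>i\<le>j. B i powr p) \<le> S powr p"
  shows "(\<Sum>i\<le>j. B i) \<le> 2 * S * real (j + 1) powr (1 - 1 / p)"
proof (cases "S = 0")
  case True
  then have "(\<Sum>i\<le>j. B i powr p) = 0" using sum p by (simp add: sum_nonneg order_antisym)
  then have "\<And>i. i \<le> j \<Longrightarrow> B i = 0" by (subst (asm) sum_nonneg_eq_0_iff) auto
  then show ?thesis using True by simp
next
  case False
  define n where "n = real (j + 1)"
  have n: "n > 0" by (simp add: n_def)
  \<comment> \<open>The level at which n l and S^p l^(1 - p) coincide.\<close>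
  define l where "l = S * n powr (- 1 / p)"
  have l: "l > 0" using False S n by (simp add: l_def)
  have "B i \<le> l + B i powr p * l powr (1 - p)" for i
  proof (cases "B i \<le> l")
    case True
    then show ?thesis by (simp add: add_increasing2)
  next
    case False
    then have "B i = B i powr p * B i powr (1 - p)" using l by (simp add: powr_add[symmetric])
    also have "\<dots> \<le> B i powr p * l powr (1 - p)"
      using False l p by (intro mult_left_mono powr_mono2') auto
    finally show ?thesis using l by linarith
  qed
  then have "(\<Sum>i\<le>j. B i) \<le> (\<Sum>i\<le>j. l + B i powr p * l powr (1 - p))" by (rule sum_mono)
  also have "\<dots> = n * l + (\<Sum>i\<le>j. B i powr p) * l powr (1 - p)"
    by (simp add: sum.distrib sum_distrib_right n_def)
  also have "\<dots> \<le> n * l + S powr p * l powr (1 - p)"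
    using sum by (intro add_left_mono mult_right_mono) auto
  also have "n * l = S * n powr (1 - 1 / p)"
  proof -
    have "n powr (1 - 1 / p) = n * n powr (- 1 / p)"
      using n powr_add[of n 1 "- 1 / p"] by simp
    then show ?thesis by (simp add: l_def)
  qed
  also have "S powr p * l powr (1 - p) = S * n powr (1 - 1 / p)"
  proof -
    have "(- 1 / p) * (1 - p) = 1 - 1 / p" using p by (simp add: field_simps)
    then have "l powr (1 - p) = S powr (1 - p) * n powr (1 - 1 / p)"
      unfolding l_def using S n by (simp add: powr_mult powr_powr)
    moreover have "S powr p * S powr (1 - p) = S"
      using False S by (simp add: powr_add[symmetric])
    ultimately show ?thesis by (simp add: mult.assoc[symmetric])
  qed
  finally show ?thesis by (simp add: n_def)
qed

text \<open>
  If \<open>m\<close> and \<open>i \<ge> m\<close> both belong to the set, then \<open>(1/2)^(m+2) < u < 2 * (1/2)^i\<close> forces \<open>i < m + 3\<close>.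
\<close>

lemma dyadic_shell_overlap:
  fixes u :: real
  shows "card {i. i \<le> j \<and> (1/2)^(i+2) < u \<and> u < 2 * (1/2)^i} \<le> 3"
proof (cases "{i. i \<le> j \<and> (1/2)^(i+2) < u \<and> u < 2 * (1/2)^i} = {}")
  case True
  then show ?thesis by (simp only: card.empty)
next
  case False
  let ?I = "{i. i \<le> j \<and> (1/2)^(i+2) < u \<and> u < 2 * (1/2)^i}"
  have fin: "finite ?I" by simp
  define m where "m = Min ?I"
  have m: "m \<in> ?I" unfolding m_def using fin False by (rule Min_in)
  have "?I \<subseteq> {m..<m+3}"
  proof
    fix i assume i: "i \<in> ?I"
    have "m \<le> i" unfolding m_def using fin i by (rule Min_le)
    moreover have "i < m + 3"
    proof (rule ccontr)
      assume "\<not> i < m + 3"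
      then have "(1/2)^i \<le> (1/2::real)^(m+3)" by (intro power_decreasing) auto
      moreover have "(1/2)^(m+2) < u" using m by simp
      moreover have "u < 2 * (1/2)^i" using i by simp
      ultimately have "(1/2)^(m+2) < 2 * (1/2::real)^(m+3)" by linarith
      then show False by (simp add: power_add power3_eq_cube)
    qed
    ultimately show "i \<in> {m..<m+3}" by simp
  qed
  then have "card ?I \<le> card {m..<m+3}" by (intro card_mono) auto
  then show ?thesis by simp
qed

lemma besov_energy_mono: "A \<subseteq> B \<Longrightarrow> besov_energy p f A \<le> besov_energy p f B"
  unfolding besov_energy_def by (intro nn_integral_mono) (auto split: split_indicator)

text \<open>
  The shell is wide enough to contain every disc of radius \<open>(1 - s) / 2\<close> whose centre \<open>s\<close> lies in
  \<open>[1 - (1/2)^j, 1 - (1/2)^Suc j]\<close> for \<open>j\<close> the index of the shell.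
\<close>

definition shell :: "nat \<Rightarrow> complex set" where
  "shell i = {w. cmod w < 1 \<and> (1/2)^(i+2) < 1 - cmod w \<and> 1 - cmod w < 2 * (1/2)^i}"

lemma shell_borel: "shell i \<in> sets borel"
  unfolding shell_def by measurable

lemma shell_energy_sum:
  assumes "f \<in> besov_space p" "p > 0"
  shows "(\<Sum>i\<le>j. besov_energy p f (shell i)) \<le> 3 * besov_energy p f unit_disc"
proof -
  have f: "f holomorphic_on unit_disc" using assms by (auto simp: besov_space_def)
  have mD: "(\<lambda>z. ennreal (besov_integrand p f z) * indicator unit_disc z) \<in> borel_measurable lborel"
    by (rule borel_measurable_besov_indicator) (use f assms in auto)
  have mS: "(\<lambda>z. ennreal (besov_integrand p f z) * indicator (shell i) z) \<in> borel_measurable lborel" for i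
    by (rule borel_measurable_besov_indicator) (use f assms shell_borel in \<open>auto simp: shell_def\<close>)
  have pt: "(\<Sum>i\<le>j. ennreal (besov_integrand p f z) * indicator (shell i) z)
      \<le> 3 * (ennreal (besov_integrand p f z) * indicator unit_disc z)" for z
  proof (cases "z \<in> unit_disc")
    case True
    have "(\<Sum>i\<le>j. indicator (shell i) z :: ennreal) = of_nat (card {i. i \<le> j \<and> z \<in> shell i})"
    proof -
      have "(\<Sum>i\<le>j. indicator (shell i) z :: ennreal) = (\<Sum>i\<in>{i. i \<le> j \<and> z \<in> shell i}. 1)"
        by (rule sum.mono_neutral_cong_right) auto
      then show ?thesis by simp
    qed
    also have "{i. i \<le> j \<and> z \<in> shell i} = {i. i \<le> j \<and> (1/2)^(i+2) < 1 - cmod z \<and> 1 - cmod z < 2 * (1/2)^i}"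
      using True by (auto simp: shell_def)
    also have "of_nat (card \<dots>) \<le> (of_nat 3 :: ennreal)"
      using dyadic_shell_overlap[of j "1 - cmod z"] by (intro of_nat_mono)
    finally have "(\<Sum>i\<le>j. indicator (shell i) z :: ennreal) \<le> 3" by simp
    then have "ennreal (besov_integrand p f z) * (\<Sum>i\<le>j. indicator (shell i) z) \<le> ennreal (besov_integrand p f z) * 3"
      by (rule mult_left_mono) simp
    then show ?thesis using True by (simp add: sum_distrib_left mult.commute)
  next
    case False
    then have "z \<notin> shell i" for i by (auto simp: shell_def)
    then show ?thesis by simp
  qed
  have "(\<Sum>i\<le>j. besov_energy p f (shell i))
      = (\<integral>\<^sup>+z. (\<Sum>i\<le>j. ennreal (besov_integrand p f z) * indicator (shell i) z) \<partial>lborel)"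
    unfolding besov_energy_def by (rule nn_integral_sum[symmetric]) (rule mS)
  also have "\<dots> \<le> (\<integral>\<^sup>+z. 3 * (ennreal (besov_integrand p f z) * indicator unit_disc z) \<partial>lborel)"
    by (intro nn_integral_mono pt)
  also have "\<dots> = 3 * besov_energy p f unit_disc"
    unfolding besov_energy_def by (rule nn_integral_cmult[OF mD])
  finally show ?thesis .
qed

lemma deriv_bound_on_segment:
  fixes f :: "complex \<Rightarrow> complex" and a b M :: real
  assumes f: "f holomorphic_on unit_disc" and ab: "0 \<le> a" "a \<le> b" "b < 1"
    and M: "\<And>s. a \<le> s \<Longrightarrow> s \<le> b \<Longrightarrow> cmod (deriv f (of_real s)) \<le> M"
  shows "cmod (f (of_real b) - f (of_real a)) \<le> M * (b - a)"
proof -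
  have "cmod (f (of_real b) - f (of_real a)) \<le> M * cmod (of_real b - of_real a)"
  proof (rule field_differentiable_bound)
    show "convex (closed_segment (of_real a) (of_real b :: complex))" by simp
    fix z :: complex assume z: "z \<in> closed_segment (of_real a) (of_real b)"
    then obtain s where s: "z = of_real s" "a \<le> s" "s \<le> b"
      using ab by (auto simp: closed_segment_of_real closed_segment_eq_real_ivl)
    then have "z \<in> unit_disc" using ab by simp
    then show "(f has_field_derivative deriv f z) (at z within closed_segment (of_real a) (of_real b))"
      using f holomorphic_derivI[OF f open_ball] by blast
    show "cmod (deriv f z) \<le> M" using M s by simp
  qed auto
  also have "cmod (of_real b - of_real a :: complex) = b - a"
    using ab by (simp flip: of_real_diff)
  finally show ?thesis .
qed

text \<open>
  The first estimate is the inclusion of the Besov space in the Bloch space. The second one has the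
  sharp exponent \<open>1 - 1/p\<close>, which summing the Bloch bound would not give: the increment of \<open>f\<close> over
  the \<open>i\<close>-th dyadic interval is at most the \<open>p\<close>-th root of the energy of the \<open>i\<close>-th shell, and the sum of
  these energies is bounded.
\<close>

lemma besov_growth:
  fixes p :: real
  assumes p: "p > 1"
  obtains C :: real where "C > 0"
    "\<And>f z. f \<in> besov_space p \<Longrightarrow> cmod z < 1 \<Longrightarrow> (1 - cmod z) * cmod (deriv f z) \<le> C * besov_norm p f"
    "\<And>f j t. f \<in> besov_space p \<Longrightarrow> 1 - (1/2)^j \<le> t \<Longrightarrow> t \<le> 1 - (1/2)^Suc j \<Longrightarrow>
       cmod (f (of_real t)) \<le> C * besov_norm p f * real (j + 1) powr (1 - 1 / p)"
proof -
  obtain C where C: "C > 0" and loc: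
    "\<And>f z. \<lbrakk>f holomorphic_on unit_disc; cmod z < 1\<rbrakk> \<Longrightarrow>
       ennreal (((1 - cmod z) * cmod (deriv f z)) powr p) \<le>
       ennreal C * besov_energy p f (ball z ((1 - cmod z) / 2))"
    using besov_local_estimate[of p] p by auto
  \<comment> \<open>The factor 3 is the overlap of the shells, and \<open>\<pi>\<close> undoes the normalisation of the area measure.\<close>
  define K where "K = (3 * C * pi) powr (1 / p)"
  have K: "K > 0" using C by (simp add: K_def)
  have Kp: "K powr p = 3 * C * pi" using C p by (simp add: K_def powr_powr)
  note nb = besov_norm_bounds[of p]
  have bloch: "(1 - cmod z) * cmod (deriv f z) \<le> (1 + 2 * K) * besov_norm p f"
    if f: "f \<in> besov_space p" and z: "cmod z < 1" for f z
  proof -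
    let ?N = "besov_norm p f"
    have N: "?N \<ge> 0" using nb p by simp
    have hol: "f holomorphic_on unit_disc" using f by (simp add: besov_space_def)
    have sub: "ball z ((1 - cmod z) / 2) \<subseteq> unit_disc"
    proof
      fix w assume "w \<in> ball z ((1 - cmod z) / 2)"
      then show "w \<in> unit_disc" using z norm_triangle_ineq2[of w z]
        by (auto simp: dist_norm norm_minus_commute)
    qed
    have "ennreal (((1 - cmod z) * cmod (deriv f z)) powr p) \<le> ennreal C * besov_energy p f unit_disc"
      using loc[OF hol z] besov_energy_mono[OF sub] order_trans mult_left_mono by fastforce
    also have "\<dots> = ennreal (C * (pi * besov_seminorm p f powr p))"
      using C p by (subst besov_energy_unit_disc[OF f]) (auto simp: ennreal_mult)
    also have "\<dots> \<le> ennreal ((K * ?N) powr p)"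
    proof (rule ennreal_leI)
      have "C * (pi * besov_seminorm p f powr p) \<le> C * (pi * ?N powr p)"
        using C nb p by (intro mult_left_mono) auto
      also have "\<dots> \<le> 3 * (C * (pi * ?N powr p))" using C by simp
      also have "\<dots> = (K * ?N) powr p" using K N by (simp add: powr_mult Kp)
      finally show "C * (pi * besov_seminorm p f powr p) \<le> (K * ?N) powr p" .
    qed
    finally have "((1 - cmod z) * cmod (deriv f z)) powr p \<le> (K * ?N) powr p" by simp
    then have "(1 - cmod z) * cmod (deriv f z) \<le> K * ?N"
      using p K N powr_less_mono2[of p "K * ?N" "(1 - cmod z) * cmod (deriv f z)"] by fastforce
    also have "\<dots> \<le> (1 + 2 * K) * ?N" using K N by (intro mult_right_mono) auto
    finally show ?thesis .
  qed
  have growth: "cmod (f (of_real t)) \<le> (1 + 2 * K) * besov_norm p f * real (j + 1) powr (1 - 1 / p)"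
    if f: "f \<in> besov_space p" and t: "1 - (1/2)^j \<le> t" "t \<le> 1 - (1/2)^Suc j" for f j t
  proof -
    let ?N = "besov_norm p f"
    have N: "?N \<ge> 0" using nb p by simp
    have hol: "f holomorphic_on unit_disc" using f by (simp add: besov_space_def)
    define e where "e i = enn2real (besov_energy p f (shell i))" for i
    have fin: "besov_energy p f (shell i) = ennreal (e i)" for i
    proof -
      have "besov_energy p f (shell i) \<le> besov_energy p f unit_disc"
        by (rule besov_energy_mono) (auto simp: shell_def)
      also have "\<dots> < top" using p by (subst besov_energy_unit_disc[OF f]) auto
      finally show ?thesis by (simp add: e_def)
    qed
    have e0: "e i \<ge> 0" for i by (simp add: e_def)
    define B where "B i = (C * e i) powr (1 / p)" for i
    have B0: "B i \<ge> 0" for i by (simp add: B_def)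
    have Bp: "B i powr p = C * e i" for i using C e0[of i] p by (simp add: B_def powr_powr)
    have der: "cmod (deriv f (of_real s)) \<le> 2 ^ Suc i * B i"
      if s: "1 - (1/2)^i \<le> s" "s \<le> 1 - (1/2)^Suc i" for s i
    proof -
      have pos: "(0::real) < (1/2)^i" "(1/2::real)^i \<le> 1" by (auto simp: power_le_one)
      have s01: "0 \<le> s" "s < 1" using s pos unfolding power_Suc by - linarith+
      have cs: "cmod (of_real s) = s" using s01 by simp
      have sub: "ball (of_real s) ((1 - s) / 2) \<subseteq> shell i"
      proof
        fix w :: complex assume "w \<in> ball (of_real s) ((1 - s) / 2)"
        then have d: "cmod (of_real s - w) < (1 - s) / 2" by (simp add: dist_norm)
        have "cmod w - s \<le> cmod (of_real s - w)" "s - cmod w \<le> cmod (of_real s - w)"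
          using norm_triangle_ineq2[of w "of_real s"] norm_triangle_ineq2[of "of_real s" w] cs
          by (auto simp: norm_minus_commute)
        then have "1 - cmod w > (1 - s) / 2" "1 - cmod w < 3 * (1 - s) / 2" using d by (simp_all add: field_simps)
        moreover have "(1 - s) / 2 \<ge> (1/2)^(i+2)" using s by simp
        moreover have "3 * (1 - s) / 2 \<le> 3 * (1/2)^i / 2"
          using s by (intro divide_right_mono mult_left_mono) auto
        moreover have "3 * (1/2)^i / 2 \<le> 2 * (1/2::real)^i" by simp
        ultimately show "w \<in> shell i" using s01 by (auto simp: shell_def)
      qed
      have "ennreal (((1 - s) * cmod (deriv f (of_real s))) powr p)
          \<le> ennreal C * besov_energy p f (ball (of_real s) ((1 - s) / 2))"
        using loc[OF hol, of "of_real s"] s01 by simp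
      also have "\<dots> \<le> ennreal C * ennreal (e i)"
        using besov_energy_mono[OF sub, of p f] fin by (intro mult_left_mono) auto
      also have "\<dots> = ennreal (B i powr p)" using C e0 by (simp add: Bp ennreal_mult)
      finally have "((1 - s) * cmod (deriv f (of_real s))) powr p \<le> B i powr p" by simp
      then have "(1 - s) * cmod (deriv f (of_real s)) \<le> B i"
        using p B0[of i] powr_less_mono2[of p "B i" "(1 - s) * cmod (deriv f (of_real s))"] by fastforce
      moreover have "(1/2)^Suc i * cmod (deriv f (of_real s)) \<le> (1 - s) * cmod (deriv f (of_real s))"
        using s by (intro mult_right_mono) auto
      ultimately have "(1/2)^Suc i * cmod (deriv f (of_real s)) \<le> B i" by linarith
      then have "2^Suc i * ((1/2)^Suc i * cmod (deriv f (of_real s))) \<le> 2^Suc i * B i"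
        by (intro mult_left_mono) auto
      then show ?thesis by (simp add: power_one_over)
    qed
    have step: "cmod (f (of_real s) - f (of_real (1 - (1/2)^i))) \<le> B i"
      if s: "1 - (1/2)^i \<le> s" "s \<le> 1 - (1/2)^Suc i" for s i
    proof -
      have pos: "(0::real) < (1/2)^i" "(1/2::real)^i \<le> 1" by (auto simp: power_le_one)
      have "cmod (f (of_real s) - f (of_real (1 - (1/2)^i))) \<le> 2 ^ Suc i * B i * (s - (1 - (1/2)^i))"
      proof (rule deriv_bound_on_segment[OF hol])
        fix u assume "1 - (1/2)^i \<le> u" "u \<le> s"
        then show "cmod (deriv f (of_real u)) \<le> 2 ^ Suc i * B i" using s by (intro der) auto
      next
        show "0 \<le> 1 - (1/2::real)^i" using pos by simp
        show "s < 1" using s pos unfolding power_Suc by linarith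
      qed (use s in auto)
      also have "\<dots> \<le> 2 ^ Suc i * B i * (1/2)^Suc i"
        using s B0 by (intro mult_left_mono) auto
      also have "\<dots> = B i" by (simp add: power_one_over)
      finally show ?thesis .
    qed
    have ind: "cmod (f (of_real (1 - (1/2)^i))) \<le> cmod (f 0) + (\<Sum>k<i. B k)" for i
    proof (induction i)
      case (Suc i)
      have "cmod (f (of_real (1 - (1/2)^Suc i)) - f (of_real (1 - (1/2)^i))) \<le> B i"
        by (rule step) auto
      then have "cmod (f (of_real (1 - (1/2)^Suc i))) \<le> cmod (f (of_real (1 - (1/2)^i))) + B i"
        using norm_triangle_ineq2[of "f (of_real (1 - (1/2)^Suc i))" "f (of_real (1 - (1/2)^i))"] by linarith
      then show ?case using Suc.IH by (simp del: of_real_diff of_real_power power_Suc)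
    qed simp
    have "cmod (f (of_real t)) \<le> cmod (f (of_real (1 - (1/2)^j))) + B j"
      using step[OF t] norm_triangle_ineq2[of "f (of_real t)" "f (of_real (1 - (1/2)^j))"] by linarith
    also have "\<dots> \<le> cmod (f 0) + (\<Sum>k\<le>j. B k)"
      using ind[of j] by (simp add: lessThan_Suc_atMost[symmetric])
    also have "(\<Sum>k\<le>j. B k) \<le> 2 * (K * ?N) * real (j + 1) powr (1 - 1 / p)"
    proof (rule sum_le_powr_sum[OF p B0])
      have "ennreal (\<Sum>i\<le>j. e i) = (\<Sum>i\<le>j. besov_energy p f (shell i))"
        using e0 by (simp add: fin sum_ennreal)
      also have "\<dots> \<le> 3 * besov_energy p f unit_disc"
        by (rule shell_energy_sum) (use f p in auto)
      also have "\<dots> = ennreal (3 * (pi * besov_seminorm p f powr p))"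
        using p by (subst besov_energy_unit_disc[OF f]) (auto simp: ennreal_mult)
      finally have "(\<Sum>i\<le>j. e i) \<le> 3 * (pi * besov_seminorm p f powr p)" by simp
      also have "\<dots> \<le> 3 * (pi * ?N powr p)" using nb p by simp
      finally have "C * (\<Sum>i\<le>j. e i) \<le> C * (3 * (pi * ?N powr p))" using C by simp
      then show "(\<Sum>i\<le>j. B i powr p) \<le> (K * ?N) powr p"
        using K N by (simp add: Bp powr_mult Kp sum_distrib_left mult_ac)
    qed (use K N in simp)
    also have "cmod (f 0) \<le> ?N * real (j + 1) powr (1 - 1 / p)"
    proof -
      have "1 \<le> real (j + 1) powr (1 - 1 / p)" using p by (intro ge_one_powr_ge_zero) auto
      then have "?N * 1 \<le> ?N * real (j + 1) powr (1 - 1 / p)" using N by (intro mult_left_mono)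
      then show ?thesis using nb[of f] p by simp
    qed
    finally show ?thesis by (simp add: algebra_simps)
  qed
  show ?thesis by (rule that[of "1 + 2 * K"]) (use K bloch growth in auto)
qed

section \<open>Dyadic estimates for logarithmic Carleson measures\<close>

text \<open>
  On the interval with index \<open>j\<close> the logarithm \<open>ln (2 / (1 - t))\<close> is comparable to \<open>j + 1\<close>.
\<close>

definition dyadic_interval :: "nat \<Rightarrow> real set" where
  "dyadic_interval j = {1 - (1/2)^j ..< 1 - (1/2)^Suc j}"

lemma dyadic_interval_cover:
  assumes "0 \<le> t" "t < 1"
  obtains j where "t \<in> dyadic_interval j"
proof -
  obtain n where n: "(1/2)^n < 1 - t"
    using real_arch_pow_inv[of "1 - t" "1/2"] assms by auto
  define k where "k = (LEAST n. (1/2)^n < 1 - t)"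
  have k: "(1/2)^k < 1 - t" unfolding k_def using n by (rule LeastI)
  have "k \<noteq> 0" using k assms by (intro notI) auto
  then obtain j where j: "k = Suc j" by (cases k) auto
  have "\<not> (1/2)^j < 1 - t" using not_less_Least[of j "\<lambda>n. (1/2)^n < 1 - t"] j k_def by simp
  then have "t \<in> dyadic_interval j" using k j by (auto simp: dyadic_interval_def)
  then show ?thesis by (rule that)
qed

lemma dyadic_interval_subset: "dyadic_interval j \<subseteq> {0..<1}"
proof -
  have "(1/2::real)^j \<le> 1" by (simp add: power_le_one)
  moreover have "(0::real) < (1/2)^Suc j" by simp
  ultimately show ?thesis unfolding dyadic_interval_def by (auto simp del: power_Suc)
qed

lemma borel_measure_on_01_sets:
  assumes "borel_measure_on_01 \<mu>"
  shows "space \<mu> = {0..<1}" "A \<in> sets borel \<Longrightarrow> A \<subseteq> {0..<1} \<Longrightarrow> A \<in> sets \<mu>"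
proof -
  have s: "sets \<mu> = sets (restrict_space borel {0..<1::real})"
    using assms by (simp add: borel_measure_on_01_def)
  show "space \<mu> = {0..<1}" using sets_eq_imp_space_eq[OF s] by (simp add: space_restrict_space)
  show "A \<in> sets \<mu>" if "A \<in> sets borel" "A \<subseteq> {0..<1}"
    using that unfolding s by (auto simp: sets_restrict_space image_iff)
qed

lemma borel_measurable_on_01:
  assumes "borel_measure_on_01 \<mu>" "continuous_on {0..<1} g"
  shows "g \<in> borel_measurable \<mu>"
proof -
  have "g \<in> borel_measurable (restrict_space borel {0..<1})"
    by (rule borel_measurable_continuous_on_restrict) fact
  moreover have "sets \<mu> = sets (restrict_space borel {0..<1::real})"
    using assms by (simp add: borel_measure_on_01_def)
  ultimately show ?thesis using measurable_cong_sets by blast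
qed

lemma log_carleson_dyadic_measure:
  assumes "borel_measure_on_01 \<mu>" "log_carleson \<gamma> 1 \<mu>"
  obtains M where "M > 0"
    "\<And>j. emeasure \<mu> (dyadic_interval j) \<le> ennreal (M * ((1/2)^j * real (j + 1) powr (-\<gamma>)))"
proof -
  obtain C where C: "C > 0" and le: "\<And>t. 0 \<le> t \<Longrightarrow> t < 1 \<Longrightarrow>
      emeasure \<mu> {t..<1} * ennreal (ln (2 / (1 - t)) powr \<gamma>) \<le> ennreal (C * (1 - t) powr 1)"
    using assms(2) unfolding log_carleson_def by blast
  define M where "M = C * ln 2 powr (-\<gamma>)"
  have "M > 0" using C by (simp add: M_def)
  moreover have "emeasure \<mu> (dyadic_interval j) \<le> ennreal (M * ((1/2)^j * real (j + 1) powr (-\<gamma>)))" for j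
  proof -
    have pos: "(0::real) < (1/2)^j" "(1/2::real)^j \<le> 1" by (auto simp: power_le_one)
    define L where "L = (real (j + 1) * ln 2) powr \<gamma>"
    have L: "L > 0" by (simp add: L_def)
    have sub: "dyadic_interval j \<subseteq> {1 - (1/2)^j..<1}"
      using dyadic_interval_subset[of j] by (auto simp: dyadic_interval_def)
    have "2 / (1 - (1 - (1/2)^j)) = (2::real) ^ Suc j" by (simp add: power_one_over)
    then have "ln (2 / (1 - (1 - (1/2)^j))) = real (j + 1) * ln (2::real)"
      by (simp only: ln_realpow) simp
    then have "emeasure \<mu> {1 - (1/2)^j..<1} * ennreal L \<le> ennreal (C * (1/2)^j)"
      using le[of "1 - (1/2)^j"] pos by (simp add: L_def)
    then have "emeasure \<mu> {1 - (1/2)^j..<1} * ennreal L * ennreal (1 / L) \<le> ennreal (C * (1/2)^j) * ennreal (1 / L)"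
      by (rule mult_right_mono) simp
    moreover have "ennreal L * ennreal (1 / L) = 1" using L by (subst ennreal_mult[symmetric]) auto
    moreover have "ennreal (C * (1/2)^j * (1 / L)) = ennreal (C * (1/2)^j) * ennreal (1 / L)"
      using C L by (intro ennreal_mult) auto
    ultimately have "emeasure \<mu> {1 - (1/2)^j..<1} \<le> ennreal (C * (1/2)^j * (1 / L))"
      by (simp only: mult.assoc mult_1_right)
    also have "C * (1/2)^j * (1 / L) = M * ((1/2)^j * real (j + 1) powr (-\<gamma>))"
    proof -
      have "L = real (j + 1) powr \<gamma> * ln 2 powr \<gamma>" unfolding L_def by (subst powr_mult) auto
      then show ?thesis by (simp add: M_def powr_minus field_simps)
    qed
    finally have "emeasure \<mu> {1 - (1/2)^j..<1} \<le> ennreal (M * ((1/2)^j * real (j + 1) powr (-\<gamma>)))" .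
    moreover have "emeasure \<mu> (dyadic_interval j) \<le> emeasure \<mu> {1 - (1/2)^j..<1}"
      using sub pos by (intro emeasure_mono borel_measure_on_01_sets(2)[OF assms(1)]) auto
    ultimately show ?thesis by (rule order_trans[rotated])
  qed
  ultimately show ?thesis using that by blast
qed

text \<open>
  The dyadic intervals cover \<open>[0, 1)\<close>, so a bound for the integrand on each of them and the Carleson
  bound for their masses control the integral. The constant \<open>M\<close> depends on the measure alone; the
  integrands of interest form a family indexed by a function \<open>f\<close> and a point \<open>z\<close> of the disc.
\<close>

lemma nn_integral_log_carleson:
  assumes "borel_measure_on_01 \<mu>" "log_carleson \<gamma> 1 \<mu>"
  obtains M where "M > 0"
    "\<And>F c. \<lbrakk>\<And>j t. t \<in> dyadic_interval j \<Longrightarrow> F t \<le> ennreal (c j); \<And>j. 0 \<le> c j;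
        summable (\<lambda>j. c j * ((1/2)^j * real (j + 1) powr (-\<gamma>)))\<rbrakk>
      \<Longrightarrow> (\<integral>\<^sup>+t. F t \<partial>\<mu>) \<le> ennreal (M * (\<Sum>j. c j * ((1/2)^j * real (j + 1) powr (-\<gamma>))))"
proof -
  obtain M where M: "M > 0" and mu:
    "\<And>j. emeasure \<mu> (dyadic_interval j) \<le> ennreal (M * ((1/2)^j * real (j + 1) powr (-\<gamma>)))"
    using log_carleson_dyadic_measure[OF assms] by blast
  have sets: "dyadic_interval j \<in> sets \<mu>" for j
    using dyadic_interval_subset by (intro borel_measure_on_01_sets(2)[OF assms(1)]) (auto simp: dyadic_interval_def)
  have "(\<integral>\<^sup>+t. F t \<partial>\<mu>) \<le> ennreal (M * (\<Sum>j. c j * ((1/2)^j * real (j + 1) powr (-\<gamma>))))"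
    if F: "\<And>j t. t \<in> dyadic_interval j \<Longrightarrow> F t \<le> ennreal (c j)" and c: "\<And>j. 0 \<le> c j"
      and sm: "summable (\<lambda>j. c j * ((1/2)^j * real (j + 1) powr (-\<gamma>)))" for F c
  proof -
    let ?w = "\<lambda>j. (1/2)^j * real (j + 1) powr (-\<gamma>)"
    have "(\<integral>\<^sup>+t. F t \<partial>\<mu>) \<le> (\<integral>\<^sup>+t. (\<Sum>j. ennreal (c j) * indicator (dyadic_interval j) t) \<partial>\<mu>)"
    proof (rule nn_integral_mono)
      fix t assume "t \<in> space \<mu>"
      then have "0 \<le> t" "t < 1" using borel_measure_on_01_sets(1)[OF assms(1)] by auto
      then obtain j where j: "t \<in> dyadic_interval j" by (rule dyadic_interval_cover)
      have "F t \<le> ennreal (c j) * indicator (dyadic_interval j) t" using F j by simp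
      also have "\<dots> = (\<Sum>i\<in>{j}. ennreal (c i) * indicator (dyadic_interval i) t)"
        by (subst sum.insert) auto
      also have "\<dots> \<le> (\<Sum>i. ennreal (c i) * indicator (dyadic_interval i) t)"
        by (rule sum_le_suminf) auto
      finally show "F t \<le> (\<Sum>i. ennreal (c i) * indicator (dyadic_interval i) t)" .
    qed
    also have "\<dots> = (\<Sum>j. \<integral>\<^sup>+t. ennreal (c j) * indicator (dyadic_interval j) t \<partial>\<mu>)"
      using sets by (intro nn_integral_suminf) auto
    also have "\<dots> = (\<Sum>j. ennreal (c j) * emeasure \<mu> (dyadic_interval j))"
      using sets by (simp add: nn_integral_cmult_indicator)
    also have "\<dots> \<le> (\<Sum>j. ennreal (M * (c j * ?w j)))"
    proof (rule suminf_le)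
      fix j
      have "ennreal (c j) * emeasure \<mu> (dyadic_interval j) \<le> ennreal (c j) * ennreal (M * ?w j)"
        using mu by (rule mult_left_mono) simp
      also have "\<dots> = ennreal (M * (c j * ?w j))"
        using c M by (subst ennreal_mult[symmetric]) (auto simp: mult_ac)
      finally show "ennreal (c j) * emeasure \<mu> (dyadic_interval j) \<le> ennreal (M * (c j * ?w j))" .
    qed auto
    also have "\<dots> = ennreal (\<Sum>j. M * (c j * ?w j))"
      using M c sm by (intro suminf_ennreal2 summable_mult) auto
    also have "(\<Sum>j. M * (c j * ?w j)) = M * (\<Sum>j. c j * ?w j)"
      by (rule suminf_mult[OF sm])
    finally show ?thesis .
  qed
  then show ?thesis using that M by blast
qed

lemma summable_geometric_powr: "summable (\<lambda>i. (1/2)^i * real (i + 1) powr \<delta>)"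
proof (rule summable_comparison_test_bigo)
  show "summable (\<lambda>i. norm ((3/4)^i :: real))" by simp
  show "(\<lambda>i. (1/2)^i * real (i + 1) powr \<delta>) \<in> O(\<lambda>i. (3/4)^i)" by real_asymp
qed

text \<open>
  The terms are largest at \<open>j = m\<close> and decay geometrically in \<open>|j - m|\<close> on both sides. The slowly varying
  factor loses only a power, as \<open>m + 1 \<le> (j + 1) (|j - m| + 1)\<close>, and the geometric decay absorbs it.
\<close>

lemma dyadic_kernel_sum:
  fixes \<delta> :: real
  assumes \<delta>: "\<delta> \<ge> 0"
  obtains K where "K > 0"
    "\<And>m::nat. summable (\<lambda>j. (1/2)^j * real (j + 1) powr (-\<delta>) * min (4^j) (4^m))"
    "\<And>m::nat. (\<Sum>j. (1/2)^j * real (j + 1) powr (-\<delta>) * min (4^j) (4^m)) \<le> K * (2^m * real (m + 1) powr (-\<delta>))"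
proof -
  define b where "b i = (1/2)^i * real (i + 1) powr \<delta>" for i :: nat
  have b: "summable b" unfolding b_def by (rule summable_geometric_powr)
  have b0: "b i \<ge> 0" for i by (simp add: b_def)
  define S where "S = (\<Sum>i. b i)"
  have S: "S > 0" unfolding S_def using b by (rule suminf_pos) (simp add: b_def)
  have pt: "(1/2)^j * real (j + 1) powr (-\<delta>) * min (4^j) (4^m)
      \<le> 2^m * real (m + 1) powr (-\<delta>) * b (if j \<le> m then m - j else j - m)" for j m :: nat
  proof (cases "j \<le> m")
    case True
    then obtain i where i: "m = j + i" using le_Suc_ex by blast
    have "(4::real)^j = 2^j * 2^j" by (simp flip: power_mult_distrib)
    moreover have "(4::real)^j \<le> 4^m" using True by (intro power_increasing) auto
    ultimately have mn: "min (4^j) (4^m) = (2^j * 2^j :: real)" by simp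
    have "real (m + 1) \<le> real (j + 1) * real (i + 1)" using i by (simp add: algebra_simps)
    then have "real (m + 1) powr \<delta> \<le> (real (j + 1) * real (i + 1)) powr \<delta>"
      using \<delta> by (intro powr_mono2) auto
    then have "real (m + 1) powr \<delta> \<le> real (j + 1) powr \<delta> * real (i + 1) powr \<delta>" by (simp add: powr_mult)
    then have q: "real (j + 1) powr (-\<delta>) \<le> real (m + 1) powr (-\<delta>) * real (i + 1) powr \<delta>"
      by (simp add: powr_minus field_simps)
    have "(1/2)^j * real (j + 1) powr (-\<delta>) * min (4^j) (4^m) = 2^j * real (j + 1) powr (-\<delta>)"
      unfolding mn by (simp add: power_one_over)
    also have "\<dots> \<le> 2^j * (real (m + 1) powr (-\<delta>) * real (i + 1) powr \<delta>)"
      using q by (intro mult_left_mono) auto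
    also have "\<dots> = 2^m * real (m + 1) powr (-\<delta>) * b i"
      by (simp add: b_def i power_add power_one_over)
    finally show ?thesis using i by simp
  next
    case False
    then obtain i where i: "j = m + i" using le_Suc_ex[of m j] by auto
    have "(4::real)^m = 2^m * 2^m" by (simp flip: power_mult_distrib)
    moreover have "(4::real)^m \<le> 4^j" using False by (intro power_increasing) auto
    ultimately have mn: "min (4^j) (4^m) = (2^m * 2^m :: real)" by simp
    have "real (j + 1) powr (-\<delta>) \<le> real (m + 1) powr (-\<delta>)"
      using False \<delta> by (intro powr_mono2') auto
    also have "\<dots> \<le> real (m + 1) powr (-\<delta>) * real (i + 1) powr \<delta>"
      using mult_left_mono[of 1 "real (i + 1) powr \<delta>" "real (m + 1) powr (-\<delta>)"] \<delta>
      by (simp add: ge_one_powr_ge_zero)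
    finally have q: "real (j + 1) powr (-\<delta>) \<le> real (m + 1) powr (-\<delta>) * real (i + 1) powr \<delta>" .
    have "(1/2)^j * real (j + 1) powr (-\<delta>) * min (4^j) (4^m) = 2^m * (1/2)^i * real (j + 1) powr (-\<delta>)"
      unfolding mn by (simp add: i power_add power_one_over)
    also have "\<dots> \<le> 2^m * (1/2)^i * (real (m + 1) powr (-\<delta>) * real (i + 1) powr \<delta>)"
      using q by (intro mult_left_mono) auto
    also have "\<dots> = 2^m * real (m + 1) powr (-\<delta>) * b i"
      by (simp add: b_def)
    finally show ?thesis using i False by simp
  qed
  have fin: "(\<Sum>j<n. b (if j \<le> m then m - j else j - m)) \<le> 2 * S" for n m :: nat
  proof -
    have "(\<Sum>j<n. b (if j \<le> m then m - j else j - m)) =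
       (\<Sum>j\<in>{j. j < n \<and> j \<le> m}. b (m - j)) + (\<Sum>j\<in>{j. j < n \<and> \<not> j \<le> m}. b (j - m))"
    proof -
      have "{..<n} = {j. j < n \<and> j \<le> m} \<union> {j. j < n \<and> \<not> j \<le> m}" by auto
      then have "(\<Sum>j<n. b (if j \<le> m then m - j else j - m)) =
        (\<Sum>j\<in>{j. j < n \<and> j \<le> m} \<union> {j. j < n \<and> \<not> j \<le> m}. b (if j \<le> m then m - j else j - m))" by simp
      also have "\<dots> = (\<Sum>j\<in>{j. j < n \<and> j \<le> m}. b (if j \<le> m then m - j else j - m)) +
         (\<Sum>j\<in>{j. j < n \<and> \<not> j \<le> m}. b (if j \<le> m then m - j else j - m))"
        by (rule sum.union_disjoint) auto
      finally show ?thesis by simp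
    qed
    also have "(\<Sum>j\<in>{j. j < n \<and> j \<le> m}. b (m - j)) = sum b ((\<lambda>j. m - j) ` {j. j < n \<and> j \<le> m})"
      by (subst sum.reindex) (auto simp: inj_on_def)
    also have "\<dots> \<le> S" unfolding S_def by (rule sum_le_suminf) (use b b0 in auto)
    also have "(\<Sum>j\<in>{j. j < n \<and> \<not> j \<le> m}. b (j - m)) = sum b ((\<lambda>j. j - m) ` {j. j < n \<and> \<not> j \<le> m})"
      by (subst sum.reindex) (auto simp: inj_on_def)
    also have "\<dots> \<le> S" unfolding S_def by (rule sum_le_suminf) (use b b0 in auto)
    finally show ?thesis by simp
  qed
  have part: "(\<Sum>j<n. (1/2)^j * real (j + 1) powr (-\<delta>) * min (4^j) (4^m))
     \<le> 2 * S * (2^m * real (m + 1) powr (-\<delta>))" for n m :: nat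
  proof -
    have "(\<Sum>j<n. (1/2)^j * real (j + 1) powr (-\<delta>) * min (4^j) (4^m))
      \<le> (\<Sum>j<n. 2^m * real (m + 1) powr (-\<delta>) * b (if j \<le> m then m - j else j - m))"
      by (rule sum_mono) (rule pt)
    also have "\<dots> = 2^m * real (m + 1) powr (-\<delta>) * (\<Sum>j<n. b (if j \<le> m then m - j else j - m))"
      by (simp add: sum_distrib_left)
    also have "\<dots> \<le> 2^m * real (m + 1) powr (-\<delta>) * (2 * S)"
      by (rule mult_left_mono[OF fin]) simp
    finally show ?thesis by (simp add: mult_ac)
  qed
  have sm: "summable (\<lambda>j. (1/2)^j * real (j + 1) powr (-\<delta>) * min (4^j) (4^m))" for m :: nat
    by (rule summableI_nonneg_bounded[OF _ part]) simp
  show ?thesis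
  proof (rule that[of "2 * S"])
    show "(\<Sum>j. (1/2)^j * real (j + 1) powr (-\<delta>) * min (4^j) (4^m)) \<le> 2 * S * (2^m * real (m + 1) powr (-\<delta>))" for m :: nat
      by (rule suminf_le_const[OF sm part])
  qed (use S sm in auto)
qed

section \<open>Integral representation of the Hankel operator\<close>

text \<open>
  Bloch functions have bounded Taylor coefficients: apply Cauchy's estimate to \<open>f'\<close> on the circle of
  radius \<open>k / (k + 1)\<close>, where \<open>f'\<close> is of order \<open>k\<close> and the power of the radius stays above \<open>1 / e\<close>.
\<close>

lemma taylor_coeffs_bounded:
  assumes f: "f holomorphic_on unit_disc" and B: "\<And>z. cmod z < 1 \<Longrightarrow> (1 - cmod z) * cmod (deriv f z) \<le> B"
  shows "\<exists>A. \<forall>k. cmod (fps_nth (fps_expansion f 0) k) \<le> A"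
proof -
  have B0: "B \<ge> 0"
  proof -
    have "0 \<le> (1 - cmod 0) * cmod (deriv f 0)" by simp
    also have "\<dots> \<le> B" by (rule B) simp
    finally show ?thesis .
  qed
  have Suc: "cmod (fps_nth (fps_expansion f 0) (Suc m)) \<le> 2 * B * exp 1" for m
  proof -
    define k where "k = real (Suc m)"
    have k: "k \<ge> 1" by (simp add: k_def)
    \<comment> \<open>The radius that balances the growth of f' against the power of r in Cauchy's estimate.\<close>
    define r where "r = k / (k + 1)"
    have r: "r > 0" "r < 1" "1 - r = 1 / (k + 1)" using k by (auto simp: r_def field_simps)
    have df: "deriv f holomorphic_on unit_disc" by (intro holomorphic_deriv f) auto
    have sub: "cball 0 r \<subseteq> unit_disc" using r by auto
    have "cmod ((deriv ^^ m) (deriv f) 0) \<le> fact m * (B * (k + 1)) / r ^ m"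
    proof (rule Cauchy_inequality)
      show "deriv f holomorphic_on ball 0 r"
        by (rule holomorphic_on_subset[OF df]) (use r in auto)
      show "continuous_on (cball 0 r) (deriv f)"
        using df sub holomorphic_on_imp_continuous_on continuous_on_subset by blast
      fix x :: complex assume "cmod (0 - x) = r"
      then have x: "cmod x = r" by simp
      then have "(1 / (k + 1)) * cmod (deriv f x) \<le> B" using B[of x] r by simp
      then show "cmod (deriv f x) \<le> B * (k + 1)" using k by (simp add: field_simps)
    qed (use r in simp)
    moreover have "(deriv ^^ m) (deriv f) 0 = (deriv ^^ Suc m) f 0" by (simp only: funpow_Suc_right o_def)
    ultimately have "cmod ((deriv ^^ Suc m) f 0) / fact (Suc m) \<le> fact m * (B * (k + 1)) / r ^ m / fact (Suc m)"
      by (intro divide_right_mono) auto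
    also have "\<dots> = B * ((k + 1) / k) * (1 / r) ^ m"
      by (simp add: k_def power_one_over divide_simps)
    also have "\<dots> \<le> B * 2 * exp 1"
    proof (intro mult_mono)
      show "(k + 1) / k \<le> 2" using k by (simp add: field_simps)
      have ir: "1 / r = 1 + 1 / k" using k by (simp add: r_def field_simps)
      have "(1 / r) ^ m \<le> (1 + 1 / k) ^ Suc m" unfolding ir using k by (intro power_increasing) auto
      also have "\<dots> \<le> exp (1 / k) ^ Suc m" using k by (intro power_mono) auto
      also have "\<dots> = exp (real (Suc m) * (1 / k))" by (rule exp_of_nat_mult[symmetric])
      also have "\<dots> = exp 1" by (simp add: k_def del: of_nat_Suc)
      finally show "(1 / r) ^ m \<le> exp 1" .
    qed (use B0 k r in auto)
    finally have "cmod ((deriv ^^ Suc m) f 0) / fact (Suc m) \<le> 2 * B * exp 1" by (simp only: mult_ac)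
    moreover have "cmod (fps_nth (fps_expansion f 0) (Suc m)) = cmod ((deriv ^^ Suc m) f 0) / fact (Suc m)"
      by (simp only: fps_expansion_def fps_nth_Abs_fps norm_divide norm_fact)
    ultimately show ?thesis by simp
  qed
  have "cmod (fps_nth (fps_expansion f 0) k) \<le> cmod (f 0) + 2 * B * exp 1" for k
    using Suc B0 by (cases k) (auto simp: fps_expansion_def intro: add_increasing)
  then show ?thesis by blast
qed

text \<open>
  These hypotheses are what the exchange of sum and integral requires: with bounded coefficients,
  the Taylor series of \<open>f\<close> is dominated by the geometric series, whose sum \<open>1 / (1 - t)\<close> is integrable.
\<close>

locale hankel_setting =
  fixes \<mu> :: "real measure" and f :: "complex \<Rightarrow> complex" and A :: real
  assumes mu: "borel_measure_on_01 \<mu>"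
    and inv: "(\<integral>\<^sup>+t. ennreal (1 / (1 - t)) \<partial>\<mu>) < \<infinity>"
    and hol: "f holomorphic_on unit_disc"
    and coeffs: "\<And>k. cmod (fps_nth (fps_expansion f 0) k) \<le> A"
begin

lemma A_nonneg: "A \<ge> 0" using coeffs[of 0] norm_ge_zero order_trans by blast

lemma in_space: "t \<in> space \<mu> \<Longrightarrow> 0 \<le> t \<and> t < 1"
  using borel_measure_on_01_sets(1)[OF mu] by auto

lemma integrable_inv: "integrable \<mu> (\<lambda>t. 1 / (1 - t))"
proof (rule integrableI_bounded)
  show "(\<lambda>t. 1 / (1 - t)) \<in> borel_measurable \<mu>"
    by (rule borel_measurable_on_01[OF mu]) (auto intro!: continuous_intros)
  have "(\<integral>\<^sup>+t. ennreal (norm (1 / (1 - t))) \<partial>\<mu>) = (\<integral>\<^sup>+t. ennreal (1 / (1 - t)) \<partial>\<mu>)"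
    by (intro nn_integral_cong) (auto dest: in_space)
  then show "(\<integral>\<^sup>+t. ennreal (norm (1 / (1 - t))) \<partial>\<mu>) < \<infinity>" using inv by simp
qed

lemma measurable_f: "(\<lambda>t. f (of_real t)) \<in> borel_measurable \<mu>"
proof (rule borel_measurable_on_01[OF mu])
  show "continuous_on {0..<1} (\<lambda>t. f (of_real t))"
    by (rule continuous_on_compose2[OF holomorphic_on_imp_continuous_on[OF hol]])
       (auto intro!: continuous_intros)
qed

lemma taylor_sums:
  assumes "cmod z < 1"
  shows "(\<lambda>k. fps_nth (fps_expansion f 0) k * z ^ k) sums f z"
  using holomorphic_power_series[OF hol, of z] assms by (simp add: fps_expansion_def)

lemma integrable_power: "integrable \<mu> (\<lambda>t. t ^ n)"
proof (rule Bochner_Integration.integrable_bound[OF integrable_inv])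
  show "(\<lambda>t. t ^ n) \<in> borel_measurable \<mu>"
    by (rule borel_measurable_on_01[OF mu]) (auto intro!: continuous_intros)
  show "AE t in \<mu>. norm (t ^ n) \<le> norm (1 / (1 - t))"
  proof (rule AE_I2)
    fix t assume t: "t \<in> space \<mu>"
    have "t ^ n \<le> 1" using in_space[OF t] by (simp add: power_le_one)
    also have "1 \<le> 1 / (1 - t)" using in_space[OF t] by (simp add: field_simps)
    finally show "norm (t ^ n) \<le> norm (1 / (1 - t))" using in_space[OF t] by simp
  qed
qed

lemma moment_nonneg: "moment \<mu> n \<ge> 0"
  unfolding moment_def using in_space by (intro Bochner_Integration.integral_nonneg) auto

lemma summable_moment: "summable (\<lambda>k. moment \<mu> (n + k))"
proof (rule summableI_nonneg_bounded)
  fix N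
  have "(\<Sum>k<N. moment \<mu> (n + k)) = (LINT t|\<mu>. (\<Sum>k<N. t ^ (n + k)))"
    unfolding moment_def by (rule Bochner_Integration.integral_sum[symmetric]) (rule integrable_power)
  also have "\<dots> \<le> (LINT t|\<mu>. 1 / (1 - t))"
  proof (rule integral_mono[OF _ integrable_inv])
    show "integrable \<mu> (\<lambda>t. \<Sum>k<N. t ^ (n + k))" using integrable_power by auto
    fix t assume t: "t \<in> space \<mu>"
    have "(\<Sum>k<N. t ^ (n + k)) \<le> (\<Sum>k<N. t ^ k)"
      using in_space[OF t] by (intro sum_mono power_decreasing) auto
    also have "\<dots> \<le> (\<Sum>k. t ^ k)" using in_space[OF t] by (intro sum_le_suminf) auto
    also have "\<dots> = 1 / (1 - t)" using in_space[OF t] by (intro suminf_geometric) auto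
    finally show "(\<Sum>k<N. t ^ (n + k)) \<le> 1 / (1 - t)" .
  qed
  finally show "(\<Sum>k<N. moment \<mu> (n + k)) \<le> (LINT t|\<mu>. 1 / (1 - t))" .
qed (rule moment_nonneg)

lemma hankel_term_sums:
  "hankel_term \<mu> f n sums (LINT t|\<mu>. of_real (t ^ n) * f (of_real t))"
proof -
  let ?a = "fps_nth (fps_expansion f 0)"
  let ?F = "\<lambda>k t. complex_of_real (t ^ (n + k)) * ?a k"
  have "(\<lambda>k. LINT t|\<mu>. ?F k t) sums (LINT t|\<mu>. (\<Sum>k. ?F k t))"
  proof (rule sums_integral)
    show "integrable \<mu> (?F k)" for k by (intro integrable_mult_left integrable_of_real integrable_power)
    show "AE t in \<mu>. summable (\<lambda>k. norm (?F k t))"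
    proof (rule AE_I2, rule summable_comparison_test')
      fix t assume t: "t \<in> space \<mu>"
      show "summable (\<lambda>k. A * t ^ k)" using in_space[OF t] by auto
      fix k :: nat assume "k \<ge> 0"
      have "t ^ (n + k) * cmod (?a k) \<le> t ^ k * A"
        using in_space[OF t] coeffs by (intro mult_mono power_decreasing) auto
      then show "norm (norm (?F k t)) \<le> A * t ^ k" using in_space[OF t] by (simp add: norm_mult norm_power mult.commute)
    qed
    show "summable (\<lambda>k. LINT t|\<mu>. norm (?F k t))"
    proof (rule summable_comparison_test')
      show "summable (\<lambda>k. moment \<mu> (n + k) * A)" by (intro summable_mult2 summable_moment)
      fix k :: nat assume "k \<ge> 0"
      have "(LINT t|\<mu>. norm (?F k t)) = (LINT t|\<mu>. t ^ (n + k) * cmod (?a k))"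
        by (intro Bochner_Integration.integral_cong) (auto simp: norm_mult norm_power dest: in_space)
      also have "\<dots> = moment \<mu> (n + k) * cmod (?a k)" by (simp add: moment_def)
      also have "\<dots> \<le> moment \<mu> (n + k) * A" using coeffs moment_nonneg by (intro mult_left_mono)
      finally show "norm (LINT t|\<mu>. norm (?F k t)) \<le> moment \<mu> (n + k) * A" by simp
    qed
  qed
  also have "(\<lambda>k. LINT t|\<mu>. ?F k t) = hankel_term \<mu> f n"
  proof
    fix k
    have "(LINT t|\<mu>. ?F k t) = (LINT t|\<mu>. complex_of_real (t ^ (n + k))) * ?a k"
      by simp
    also have "(LINT t|\<mu>. complex_of_real (t ^ (n + k))) = of_real (moment \<mu> (n + k))"
      unfolding moment_def by (rule integral_complex_of_real)
    finally show "(LINT t|\<mu>. ?F k t) = hankel_term \<mu> f n k" by (simp add: hankel_term_def)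
  qed
  also have "(LINT t|\<mu>. (\<Sum>k. ?F k t)) = (LINT t|\<mu>. of_real (t ^ n) * f (of_real t))"
  proof (rule Bochner_Integration.integral_cong[OF refl])
    fix t assume t: "t \<in> space \<mu>"
    have "(\<lambda>k. of_real (t ^ n) * (?a k * of_real t ^ k)) sums (of_real (t ^ n) * f (of_real t))"
      by (intro sums_mult taylor_sums) (use in_space[OF t] in auto)
    then show "(\<Sum>k. ?F k t) = of_real (t ^ n) * f (of_real t)"
      by (simp add: sums_iff power_add mult_ac)
  qed
  finally show ?thesis .
qed

lemma hankel_coeff_eq: "hankel_coeff \<mu> f n = (LINT t|\<mu>. of_real (t ^ n) * f (of_real t))"
  unfolding hankel_coeff_def using hankel_term_sums by (rule sums_unique[symmetric])

lemma integrable_f: "integrable \<mu> (\<lambda>t. f (of_real t))"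
proof (rule Bochner_Integration.integrable_bound[OF integrable_mult_right[OF integrable_inv, of A]])
  show "(\<lambda>t. f (of_real t)) \<in> borel_measurable \<mu>" by (rule measurable_f)
  show "AE t in \<mu>. norm (f (of_real t)) \<le> norm (A * (1 / (1 - t)))"
  proof (rule AE_I2)
    fix t assume t: "t \<in> space \<mu>"
    let ?a = "fps_nth (fps_expansion f 0)"
    have t1: "norm t < 1" using in_space[OF t] by simp
    have b: "norm (?a k * of_real t ^ k) \<le> A * t ^ k" for k
      using in_space[OF t] coeffs[of k] by (simp add: norm_mult norm_power mult_right_mono)
    have s: "(\<lambda>k. A * t ^ k) sums (A * (1 / (1 - t)))" by (intro sums_mult geometric_sums t1)
    have "f (of_real t) = (\<Sum>k. ?a k * of_real t ^ k)"
      using taylor_sums[of "of_real t"] t1 by (simp add: sums_iff)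
    also have "norm \<dots> \<le> (\<Sum>k. A * t ^ k)" by (rule norm_suminf_le[OF b sums_summable[OF s]])
    also have "\<dots> = A * (1 / (1 - t))" using s by (rule sums_unique[symmetric])
    finally show "norm (f (of_real t)) \<le> norm (A * (1 / (1 - t)))"
      using A_nonneg t1 by (simp add: abs_mult)
  qed
qed

lemma norm_power_f_le:
  assumes "t \<in> space \<mu>"
  shows "norm (of_real (t ^ n) * f (of_real t)) \<le> norm (f (of_real t))"
proof -
  have "norm (of_real (t ^ n) * f (of_real t)) = t ^ n * norm (f (of_real t))"
    using in_space[OF assms] by (simp add: norm_mult norm_power)
  also have "\<dots> \<le> 1 * norm (f (of_real t))"
    using in_space[OF assms] by (intro mult_right_mono power_le_one) auto
  finally show ?thesis by simp
qed

lemma integrable_power_f: "integrable \<mu> (\<lambda>t. of_real (t ^ n) * f (of_real t))"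
proof (rule Bochner_Integration.integrable_bound[OF integrable_f])
  have "(\<lambda>t. complex_of_real (t ^ n)) \<in> borel_measurable \<mu>"
    by (rule borel_measurable_on_01[OF mu]) (auto intro!: continuous_intros)
  then show "(\<lambda>t. of_real (t ^ n) * f (of_real t)) \<in> borel_measurable \<mu>"
    using measurable_f by (rule borel_measurable_times)
  show "AE t in \<mu>. norm (of_real (t ^ n) * f (of_real t)) \<le> norm (f (of_real t))"
    by (rule AE_I2) (rule norm_power_f_le)
qed

definition f_mass :: real where "f_mass = (LINT t|\<mu>. cmod (f (of_real t)))"

lemma norm_power_f_integral_le: "(LINT t|\<mu>. norm (of_real (t ^ n) * f (of_real t))) \<le> f_mass"
  unfolding f_mass_def
  by (rule integral_mono[OF integrable_norm[OF integrable_power_f] integrable_norm[OF integrable_f]])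
     (rule norm_power_f_le)

lemma hankel_coeff_bound: "cmod (hankel_coeff \<mu> f n) \<le> f_mass"
  unfolding hankel_coeff_eq by (rule order_trans[OF integral_norm_bound norm_power_f_integral_le])

lemma summable_hankel_series:
  assumes "cmod z < 1"
  shows "summable (\<lambda>n. hankel_coeff \<mu> f n * z ^ n)"
proof (rule summable_comparison_test')
  show "summable (\<lambda>n. f_mass * cmod z ^ n)" using assms by auto
  show "norm (hankel_coeff \<mu> f n * z ^ n) \<le> f_mass * cmod z ^ n" for n
    unfolding norm_mult norm_power by (rule mult_right_mono[OF hankel_coeff_bound]) simp
qed

lemma hankel_op_holomorphic: "hankel_op \<mu> f holomorphic_on unit_disc"
proof (rule power_series_holomorphic[where a = "hankel_coeff \<mu> f" and z = 0 and r = 1])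
  fix w :: complex assume "w \<in> unit_disc"
  then have "(\<lambda>n. hankel_coeff \<mu> f n * w ^ n) sums hankel_op \<mu> f w"
    unfolding hankel_op_def by (intro summable_sums summable_hankel_series) simp
  then show "(\<lambda>n. hankel_coeff \<mu> f n * (w - 0) ^ n) sums hankel_op \<mu> f w" by simp
qed

lemma hankel_op_well_defined: "hankel_op_well_defined \<mu> f"
  unfolding hankel_op_well_defined_def
proof (intro conjI allI ballI)
  show "summable (hankel_term \<mu> f n)" for n using hankel_term_sums by (rule sums_summable)
  show "summable (\<lambda>n. hankel_coeff \<mu> f n * z ^ n)" if "z \<in> unit_disc" for z
    using that by (intro summable_hankel_series) simp
qed (rule hankel_op_holomorphic)

lemma hankel_op_0: "cmod (hankel_op \<mu> f 0) \<le> f_mass"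
proof -
  have "hankel_op \<mu> f 0 = hankel_coeff \<mu> f 0"
    unfolding hankel_op_def by (rule powser_zero)
  then show ?thesis using hankel_coeff_bound by simp
qed

lemma nn_integral_f: "ennreal f_mass = (\<integral>\<^sup>+t. ennreal (cmod (f (of_real t))) \<partial>\<mu>)"
  unfolding f_mass_def
  by (rule nn_integral_eq_integral[symmetric]) (use integrable_norm[OF integrable_f] in auto)

text \<open>
  Differentiate the power series of the image termwise and use
  \<open>\<Sum>n. (n + 1) w\<^sup>n = 1 / (1 - w)\<^sup>2\<close> for \<open>w = t z\<close> under the integral sign.
\<close>

lemma deriv_hankel_op:
  assumes z: "cmod z < 1"
  shows "deriv (hankel_op \<mu> f) z = (LINT t|\<mu>. of_real t * f (of_real t) / (1 - of_real t * z)\<^sup>2)"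
proof -
  let ?c = "hankel_coeff \<mu> f"
  obtain r where r: "cmod z < r" "r < 1" using dense[OF z] by blast
  have r0: "0 < r" using r norm_ge_zero[of z] by linarith
  have "((\<lambda>w. \<Sum>n. ?c n * w ^ n) has_field_derivative (\<Sum>n. diffs ?c n * z ^ n)) (at z)"
  proof (rule termdiffs_strong)
    show "summable (\<lambda>n. ?c n * complex_of_real r ^ n)"
      using r r0 by (intro summable_hankel_series) simp
  qed (use r r0 in simp)
  then have d: "deriv (hankel_op \<mu> f) z = (\<Sum>n. diffs ?c n * z ^ n)"
    unfolding hankel_op_def[abs_def] by (rule DERIV_imp_deriv)
  let ?F = "\<lambda>n t. of_nat (Suc n) * z ^ n * (complex_of_real (t ^ Suc n) * f (of_real t))"
  have "(\<lambda>n. LINT t|\<mu>. ?F n t) sums (LINT t|\<mu>. (\<Sum>n. ?F n t))"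
  proof (rule sums_integral)
    show "integrable \<mu> (?F n)" for n by (intro integrable_mult_right integrable_power_f)
    have g: "summable (\<lambda>n. of_nat (Suc n) * cmod z ^ n)"
      using geometric_deriv_sums[of "cmod z"] z by (auto simp: sums_iff)
    show "AE t in \<mu>. summable (\<lambda>n. norm (?F n t))"
    proof (rule AE_I2, rule summable_comparison_test')
      fix t assume t: "t \<in> space \<mu>"
      show "summable (\<lambda>n. of_nat (Suc n) * cmod z ^ n * cmod (f (of_real t)))"
        by (rule summable_mult2[OF g])
      fix n :: nat assume "n \<ge> 0"
      have "norm (?F n t) = of_nat (Suc n) * cmod z ^ n * (t ^ Suc n * cmod (f (of_real t)))"
        using in_space[OF t] by (simp only: norm_mult norm_power norm_of_nat norm_of_real abs_of_nonneg zero_le_power)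
      also have "\<dots> \<le> of_nat (Suc n) * cmod z ^ n * (1 * cmod (f (of_real t)))"
        using in_space[OF t] by (intro mult_left_mono mult_right_mono power_le_one) auto
      finally show "norm (norm (?F n t)) \<le> of_nat (Suc n) * cmod z ^ n * cmod (f (of_real t))"
        by simp
    qed
    show "summable (\<lambda>n. LINT t|\<mu>. norm (?F n t))"
    proof (rule summable_comparison_test')
      show "summable (\<lambda>n. of_nat (Suc n) * cmod z ^ n * f_mass)" by (rule summable_mult2[OF g])
      fix n :: nat assume "n \<ge> 0"
      have "(LINT t|\<mu>. norm (?F n t)) =
          of_nat (Suc n) * cmod z ^ n * (LINT t|\<mu>. norm (complex_of_real (t ^ Suc n) * f (of_real t)))"
        by (subst integral_mult_right_zero[symmetric]) (simp only: norm_mult norm_power norm_of_nat)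
      also have "\<dots> \<le> of_nat (Suc n) * cmod z ^ n * f_mass"
        by (intro mult_left_mono norm_power_f_integral_le) auto
      finally show "norm (LINT t|\<mu>. norm (?F n t)) \<le> of_nat (Suc n) * cmod z ^ n * f_mass"
        by simp
    qed
  qed
  also have "(\<lambda>n. LINT t|\<mu>. ?F n t) = (\<lambda>n. diffs ?c n * z ^ n)"
  proof
    fix n
    have "(LINT t|\<mu>. ?F n t) = of_nat (Suc n) * z ^ n * ?c (Suc n)"
      unfolding hankel_coeff_eq by (rule integral_mult_right_zero)
    then show "(LINT t|\<mu>. ?F n t) = diffs ?c n * z ^ n" by (simp add: diffs_def mult_ac)
  qed
  also have "(LINT t|\<mu>. (\<Sum>n. ?F n t)) = (LINT t|\<mu>. of_real t * f (of_real t) / (1 - of_real t * z)\<^sup>2)"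
  proof (rule Bochner_Integration.integral_cong[OF refl])
    fix t assume t: "t \<in> space \<mu>"
    have "cmod (of_real t * z) < 1"
    proof -
      have "cmod (of_real t * z) = t * cmod z" using in_space[OF t] by (simp add: norm_mult)
      also have "\<dots> \<le> 1 * cmod z" using in_space[OF t] by (intro mult_right_mono) auto
      finally show ?thesis using z by simp
    qed
    then have "(\<lambda>n. of_nat (Suc n) * (of_real t * z) ^ n) sums (1 / (1 - of_real t * z)\<^sup>2)"
      by (rule geometric_deriv_sums)
    then have "(\<lambda>n. of_real t * f (of_real t) * (of_nat (Suc n) * (of_real t * z) ^ n)) sums
        (of_real t * f (of_real t) * (1 / (1 - of_real t * z)\<^sup>2))" by (rule sums_mult)
    moreover have "(\<lambda>n. of_real t * f (of_real t) * (of_nat (Suc n) * (of_real t * z) ^ n)) = (\<lambda>n. ?F n t)"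
      by (simp add: fun_eq_iff power_mult_distrib mult_ac)
    ultimately show "(\<Sum>n. ?F n t) = of_real t * f (of_real t) / (1 - of_real t * z)\<^sup>2"
      by (simp only: sums_iff) simp
  qed
  finally show ?thesis using d by (simp add: sums_iff)
qed

text \<open>
  Put absolute values under the integral sign and estimate the factor \<open>t\<close> by \<open>1\<close>. In the case of a
  non-integrable integrand the Bochner integral is \<open>0\<close> by convention.
\<close>

lemma deriv_hankel_op_bound:
  assumes z: "cmod z < 1"
  shows "ennreal (cmod (deriv (hankel_op \<mu> f) z)) \<le>
    (\<integral>\<^sup>+t. ennreal (cmod (f (of_real t)) / (cmod (1 - of_real t * z))\<^sup>2) \<partial>\<mu>)"
proof (cases "integrable \<mu> (\<lambda>t. of_real t * f (of_real t) / (1 - of_real t * z)\<^sup>2)")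
  case True
  have "ennreal (cmod (deriv (hankel_op \<mu> f) z)) \<le>
      (\<integral>\<^sup>+t. ennreal (norm (of_real t * f (of_real t) / (1 - of_real t * z)\<^sup>2)) \<partial>\<mu>)"
    unfolding deriv_hankel_op[OF z] using integral_norm_bound_ennreal[OF True] .
  also have "\<dots> \<le> (\<integral>\<^sup>+t. ennreal (cmod (f (of_real t)) / (cmod (1 - of_real t * z))\<^sup>2) \<partial>\<mu>)"
  proof (intro nn_integral_mono ennreal_leI)
    fix t assume "t \<in> space \<mu>"
    from divide_right_mono[OF norm_power_f_le[OF this, of 1], of "(cmod (1 - of_real t * z))\<^sup>2"]
    show "norm (of_real t * f (of_real t) / (1 - of_real t * z)\<^sup>2)
        \<le> cmod (f (of_real t)) / (cmod (1 - of_real t * z))\<^sup>2"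
      by (simp add: norm_divide norm_power)
  qed
  finally show ?thesis .
next
  case False
  then show ?thesis unfolding deriv_hankel_op[OF z] by (simp add: not_integrable_integral_eq)
qed

end

lemma hankel_op_linear:
  assumes f: "f holomorphic_on unit_disc" "hankel_op_well_defined \<mu> f"
    and g: "g holomorphic_on unit_disc" "hankel_op_well_defined \<mu> g" and z: "z \<in> unit_disc"
  shows "hankel_op \<mu> (\<lambda>w. a * f w + b * g w) z = a * hankel_op \<mu> f z + b * hankel_op \<mu> g z"
proof -
  have "(deriv ^^ k) (\<lambda>w. a * f w + b * g w) 0 = a * (deriv ^^ k) f 0 + b * (deriv ^^ k) g 0" for k
  proof -
    have "(deriv ^^ k) (\<lambda>w. a * f w + b * g w) 0 = (deriv ^^ k) (\<lambda>w. a * f w) 0 + (deriv ^^ k) (\<lambda>w. b * g w) 0"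
      by (rule higher_deriv_add[where S = unit_disc]) (use f g in \<open>auto intro!: holomorphic_intros\<close>)
    also have "(deriv ^^ k) (\<lambda>w. a * f w) 0 = a * (deriv ^^ k) f 0"
      by (rule higher_deriv_cmult[where A = unit_disc]) (use f in auto)
    also have "(deriv ^^ k) (\<lambda>w. b * g w) 0 = b * (deriv ^^ k) g 0"
      by (rule higher_deriv_cmult[where A = unit_disc]) (use g in auto)
    finally show ?thesis .
  qed
  then have t: "hankel_term \<mu> (\<lambda>w. a * f w + b * g w) n k = a * hankel_term \<mu> f n k + b * hankel_term \<mu> g n k" for n k
    by (simp add: hankel_term_def fps_expansion_def add_divide_distrib algebra_simps)
  have c: "hankel_coeff \<mu> (\<lambda>w. a * f w + b * g w) n = a * hankel_coeff \<mu> f n + b * hankel_coeff \<mu> g n" for n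
    using f(2) g(2) unfolding hankel_coeff_def t hankel_op_well_defined_def
    by (simp add: suminf_add[symmetric] suminf_mult summable_mult)
  have "(\<lambda>n. a * (hankel_coeff \<mu> f n * z ^ n) + b * (hankel_coeff \<mu> g n * z ^ n)) sums
      (a * hankel_op \<mu> f z + b * hankel_op \<mu> g z)"
    unfolding hankel_op_def using f(2) g(2) z
    by (intro sums_add sums_mult summable_sums) (auto simp: hankel_op_well_defined_def)
  then show ?thesis unfolding hankel_op_def[of \<mu> "\<lambda>w. a * f w + b * g w"]
    by (simp add: c sums_iff algebra_simps)
qed

section \<open>Boundedness of the Hankel operator\<close>

lemma summable_Suc_powr: "s > 1 \<Longrightarrow> summable (\<lambda>m. real (m + 1) powr (- s))"
  using summable_real_powr_iff[of "-s"] summable_Suc_iff[of "\<lambda>n. real n powr (-s)"] by simp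

text \<open>
  The dyadic series behind this integral is \<open>\<Sum>j. (j + 1) powr (- \<gamma>)\<close>; its convergence is where \<open>\<gamma> > 1\<close>
  makes the operator well defined.
\<close>

lemma log_carleson_inverse_finite:
  assumes "borel_measure_on_01 \<mu>" "log_carleson \<gamma> 1 \<mu>" "\<gamma> > 1"
  shows "(\<integral>\<^sup>+t. ennreal (1 / (1 - t)) \<partial>\<mu>) < \<infinity>"
proof -
  obtain M where bd: "\<And>F c. \<lbrakk>\<And>j t. t \<in> dyadic_interval j \<Longrightarrow> F t \<le> ennreal (c j); \<And>j. 0 \<le> c j;
        summable (\<lambda>j. c j * ((1/2)^j * real (j + 1) powr (-\<gamma>)))\<rbrakk>
      \<Longrightarrow> (\<integral>\<^sup>+t. F t \<partial>\<mu>) \<le> ennreal (M * (\<Sum>j. c j * ((1/2)^j * real (j + 1) powr (-\<gamma>))))"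
    using nn_integral_log_carleson[OF assms(1,2)] by blast
  have "(\<integral>\<^sup>+t. ennreal (1 / (1 - t)) \<partial>\<mu>)
      \<le> ennreal (M * (\<Sum>j. 2 ^ Suc j * ((1/2)^j * real (j + 1) powr (-\<gamma>))))"
  proof (rule bd)
    fix j t assume t: "t \<in> dyadic_interval j"
    then have h: "(1/2)^Suc j \<le> 1 - t" by (auto simp: dyadic_interval_def)
    have "(0::real) < (1/2)^Suc j" by simp
    with h have "1 / (1 - t) \<le> 1 / (1/2)^Suc j" by (intro divide_left_mono mult_pos_pos) linarith+
    then show "ennreal (1 / (1 - t)) \<le> ennreal (2 ^ Suc j)"
      by (intro ennreal_leI) (simp add: power_one_over)
  next
    have "2 ^ Suc j * ((1/2)^j * real (j + 1) powr (-\<gamma>)) = 2 * real (j + 1) powr (-\<gamma>)" for j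
      by (simp add: power_one_over)
    then show "summable (\<lambda>j. 2 ^ Suc j * ((1/2)^j * real (j + 1) powr (-\<gamma>)))"
      using summable_Suc_powr[OF assms(3)] by (simp only: summable_mult)
  qed simp
  also have "\<dots> < \<infinity>" by simp
  finally show ?thesis .
qed

lemma kernel_lower_bounds:
  assumes "0 \<le> t" "t < 1" "cmod z < 1"
  shows "1 - t \<le> cmod (1 - of_real t * z)" "cmod (1 - z) / 2 \<le> cmod (1 - of_real t * z)"
proof -
  have tz: "cmod (of_real t * z) \<le> t" using assms by (simp add: norm_mult mult_left_le)
  show 1: "1 - t \<le> cmod (1 - of_real t * z)"
    using norm_triangle_ineq2[of 1 "of_real t * z"] tz by simp
  \<comment> \<open>1 - z = (1 - t z) - (1 - t) z, and the second term is at most 1 - t, hence at most |1 - t z|.\<close>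
  have "cmod (1 - z) \<le> cmod (1 - of_real t * z) + cmod (of_real (1 - t) * z)"
    using norm_triangle_ineq4[of "1 - of_real t * z" "of_real (1 - t) * z"] by (simp add: algebra_simps)
  also have "cmod (of_real (1 - t) * z) \<le> 1 - t" 
  proof -
    have "cmod (of_real (1 - t) * z) = (1 - t) * cmod z" using assms by (simp only: norm_mult norm_of_real)
    then show ?thesis using assms by (simp add: mult_left_le)
  qed
  finally show "cmod (1 - z) / 2 \<le> cmod (1 - of_real t * z)" using 1 by simp
qed

text \<open>
  On the \<open>j\<close>-th dyadic interval the kernel \<open>1 / |1 - t z|\<^sup>2\<close> is at most \<open>4 min (4^j) (4^m)\<close>. The growth of \<open>f\<close> and the
  mass of the interval contribute the factor \<open>2\<^sup>-\<^sup>j (j + 1) powr (- \<delta>)\<close> with \<open>\<delta> = \<gamma> - (1 - 1/p)\<close>.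
\<close>

lemma hankel_kernel_bound:
  fixes p \<gamma> :: real
  assumes p: "p > 1" and \<gamma>: "\<gamma> > 1"
    and mu: "borel_measure_on_01 \<mu>" "log_carleson \<gamma> 1 \<mu>"
  obtains K where "K > 0"
    "\<And>f z m. \<lbrakk>f \<in> besov_space p; cmod z < 1; (1/2)^m \<le> cmod (1 - z)\<rbrakk> \<Longrightarrow>
       (\<integral>\<^sup>+t. ennreal (cmod (f (of_real t)) / (cmod (1 - of_real t * z))\<^sup>2) \<partial>\<mu>)
         \<le> ennreal (K * besov_norm p f * (2^m * real (m + 1) powr (-(\<gamma> - (1 - 1 / p)))))"
proof -
  define \<delta> where "\<delta> = \<gamma> - (1 - 1 / p)"
  have "0 < 1 / p" using p by simp
  then have "\<delta> \<ge> 0" using \<gamma> unfolding \<delta>_def by linarith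
  then obtain K0 where K0: "K0 > 0"
    and sm: "\<And>m::nat. summable (\<lambda>j. (1/2)^j * real (j + 1) powr (-\<delta>) * min (4^j) (4^m))"
    and le: "\<And>m::nat. (\<Sum>j. (1/2)^j * real (j + 1) powr (-\<delta>) * min (4^j) (4^m)) \<le> K0 * (2^m * real (m + 1) powr (-\<delta>))"
    using dyadic_kernel_sum by blast
  obtain C where C: "C > 0" and gr:
    "\<And>f j t. f \<in> besov_space p \<Longrightarrow> 1 - (1/2)^j \<le> t \<Longrightarrow> t \<le> 1 - (1/2)^Suc j \<Longrightarrow>
       cmod (f (of_real t)) \<le> C * besov_norm p f * real (j + 1) powr (1 - 1 / p)"
    using besov_growth[OF p] by metis
  obtain M where M: "M > 0" and bd: "\<And>F c. \<lbrakk>\<And>j t. t \<in> dyadic_interval j \<Longrightarrow> F t \<le> ennreal (c j); \<And>j. 0 \<le> c j;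
        summable (\<lambda>j. c j * ((1/2)^j * real (j + 1) powr (-\<gamma>)))\<rbrakk>
      \<Longrightarrow> (\<integral>\<^sup>+t. F t \<partial>\<mu>) \<le> ennreal (M * (\<Sum>j. c j * ((1/2)^j * real (j + 1) powr (-\<gamma>))))"
    using nn_integral_log_carleson[OF mu] by blast
  have "(\<integral>\<^sup>+t. ennreal (cmod (f (of_real t)) / (cmod (1 - of_real t * z))\<^sup>2) \<partial>\<mu>)
         \<le> ennreal (M * 4 * C * K0 * besov_norm p f * (2^m * real (m + 1) powr (-\<delta>)))"
    if f: "f \<in> besov_space p" and z: "cmod z < 1" and m: "(1/2)^m \<le> cmod (1 - z)" for f z m
  proof -
    let ?N = "besov_norm p f"
    have N: "?N \<ge> 0" using besov_norm_bounds p by simp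
    \<comment> \<open>Growth of f times the maximum of the kernel on the j-th interval.\<close>
    define c where "c j = C * ?N * real (j + 1) powr (1 - 1 / p) * (4 * min (4^j) (4^m))" for j :: nat
    have c0: "c j \<ge> 0" for j using C N by (simp add: c_def)
    have ce: "c j * ((1/2)^j * real (j + 1) powr (-\<gamma>)) =
        4 * C * ?N * ((1/2)^j * real (j + 1) powr (-\<delta>) * min (4^j) (4^m))" for j
    proof -
      have "real (j + 1) powr (-\<delta>) = real (j + 1) powr (1 - 1 / p) * real (j + 1) powr (-\<gamma>)"
        by (subst powr_add[symmetric]) (simp add: \<delta>_def)
      then show ?thesis by (simp add: c_def)
    qed
    have "(\<integral>\<^sup>+t. ennreal (cmod (f (of_real t)) / (cmod (1 - of_real t * z))\<^sup>2) \<partial>\<mu>)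
       \<le> ennreal (M * (\<Sum>j. c j * ((1/2)^j * real (j + 1) powr (-\<gamma>))))"
    proof (rule bd)
      fix j t assume t: "t \<in> dyadic_interval j"
      then have t01: "0 \<le> t" "t < 1" using dyadic_interval_subset[of j] by auto
      have tj: "1 - (1/2)^j \<le> t" "t \<le> 1 - (1/2)^Suc j" using t by (auto simp: dyadic_interval_def)
      let ?d = "cmod (1 - of_real t * z)"
      have "(1/2)^Suc j \<le> ?d" using kernel_lower_bounds(1)[OF t01 z] tj by linarith
      moreover have "(1/2)^Suc m \<le> ?d" using kernel_lower_bounds(2)[OF t01 z] m by simp
      moreover have inv: "1 / ?d\<^sup>2 \<le> 4 * 4 ^ i" if "(1/2)^Suc i \<le> ?d" for i
      proof -
        have "((1/2::real)^Suc i)\<^sup>2 = ((1/2)\<^sup>2)^Suc i" by (simp only: power_mult[symmetric] mult.commute)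
        then have "1 / (4 * 4^i) = ((1/2::real)^Suc i)\<^sup>2" by (simp add: power_one_over power2_eq_square)
        also have "\<dots> \<le> ?d\<^sup>2" using that by (intro power_mono) auto
        finally have "1 / (4 * 4^i) \<le> ?d\<^sup>2" .
        moreover have "(0::real) < 1 / (4 * 4^i)" by simp
        ultimately have "1 / ?d\<^sup>2 \<le> 1 / (1 / (4 * 4^i))"
          by (intro divide_left_mono mult_pos_pos) linarith+
        then show ?thesis by simp
      qed
      ultimately have "1 / ?d\<^sup>2 \<le> 4 * min (4^j) (4^m)" using inv[of j] inv[of m] by (simp add: min_def)
      then have "cmod (f (of_real t)) * (1 / ?d\<^sup>2) \<le> C * ?N * real (j + 1) powr (1 - 1 / p) * (4 * min (4^j) (4^m))"
        using C N by (intro mult_mono gr[OF f tj]) auto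
      then show "ennreal (cmod (f (of_real t)) / ?d\<^sup>2) \<le> ennreal (c j)"
        by (intro ennreal_leI) (simp add: c_def)
    next
      show "summable (\<lambda>j. c j * ((1/2)^j * real (j + 1) powr (-\<gamma>)))"
        unfolding ce by (intro summable_mult sm)
    qed (rule c0)
    also have "(\<Sum>j. c j * ((1/2)^j * real (j + 1) powr (-\<gamma>))) =
        4 * C * ?N * (\<Sum>j. (1/2)^j * real (j + 1) powr (-\<delta>) * min (4^j) (4^m))"
      unfolding ce by (rule suminf_mult[OF sm])
    also have "ennreal (M * (4 * C * ?N * (\<Sum>j. (1/2)^j * real (j + 1) powr (-\<delta>) * min (4^j) (4^m))))
       \<le> ennreal (M * (4 * C * ?N * (K0 * (2^m * real (m + 1) powr (-\<delta>)))))"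
      using M C N by (intro ennreal_leI mult_left_mono le) auto
    finally show ?thesis by (simp add: mult_ac)
  qed
  moreover have "M * 4 * C * K0 > 0" using M C K0 by simp
  ultimately show ?thesis using that[of "M * 4 * C * K0"] unfolding \<delta>_def by blast
qed

text \<open>
  Cut the disc into the annuli \<open>(1/2)^m \<le> |1 - z| < 2 * (1/2)^m\<close>. The factor \<open>2^(m p)\<close> from the derivative
  cancels against the mass of the weight, and \<open>(m + 1) powr (- \<delta> p)\<close> remains.
\<close>

lemma besov_energy_power_decay:
  fixes p \<delta> :: real
  assumes p: "p > 1" and \<delta>: "\<delta> * p > 1"
  obtains K where "K > 0"
    "\<And>g B. \<lbrakk>B \<ge> 0; \<And>z m. \<lbrakk>cmod z < 1; (1/2)^m \<le> cmod (1 - z)\<rbrakk> \<Longrightarrow>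
          cmod (deriv g z) \<le> B * (2^m * real (m + 1) powr (-\<delta>))\<rbrakk>
       \<Longrightarrow> besov_energy p g unit_disc \<le> ennreal (K * B powr p)"
proof -
  obtain W where W: "W > 0" and wt: "\<And>\<rho>. 0 < \<rho> \<Longrightarrow> \<rho> \<le> 2 \<Longrightarrow>
    (\<integral>\<^sup>+z\<in>ball 0 1 \<inter> ball 1 \<rho>. ennreal ((1 - (cmod z)\<^sup>2) powr (p - 2)) \<partial>lborel) \<le> ennreal (W * \<rho> powr ((p - 2) + 2))"
    using weight_integral_local[of "p - 2"] p by auto
  have sm: "summable (\<lambda>m. real (m + 1) powr (-(\<delta> * p)))" by (rule summable_Suc_powr[OF \<delta>])
  define S where "S = (\<Sum>m. real (m + 1) powr (-(\<delta> * p)))"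
  have S: "S > 0" unfolding S_def by (rule suminf_pos[OF sm]) simp
  define K where "K = W * 2 powr p * S"
  have "K > 0" using W S by (simp add: K_def)
  moreover have "besov_energy p g unit_disc \<le> ennreal (K * B powr p)"
    if B: "B \<ge> 0" and dg: "\<And>z m. \<lbrakk>cmod z < 1; (1/2)^m \<le> cmod (1 - z)\<rbrakk> \<Longrightarrow>
          cmod (deriv g z) \<le> B * (2^m * real (m + 1) powr (-\<delta>))" for g B
  proof -
    let ?r = "\<lambda>m::nat. 2 * (1/2::real)^m"
    let ?w = "\<lambda>z. ennreal ((1 - (cmod z)\<^sup>2) powr (p - 2))"
    define a where "a m = (B * (2^m * real (m + 1) powr (-\<delta>))) powr p" for m
    have "besov_energy p g unit_disc
       \<le> (\<integral>\<^sup>+z. (\<Sum>m. ennreal (a m) * (?w z * indicator (ball 0 1 \<inter> ball 1 (?r m)) z)) \<partial>lborel)"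
      unfolding besov_energy_def
    proof (rule nn_integral_mono)
      fix z :: complex
      show "ennreal (besov_integrand p g z) * indicator unit_disc z
         \<le> (\<Sum>m. ennreal (a m) * (?w z * indicator (ball 0 1 \<inter> ball 1 (?r m)) z))"
      proof (cases "z \<in> unit_disc")
        case True
        then have z: "cmod z < 1" by simp
        have "z \<noteq> 1" using z by auto
        then have pos: "cmod (1 - z) > 0" by simp
        have "cmod (1 - z) < 2" using z norm_triangle_ineq4[of 1 z] by simp
        then have "cmod (1 - z) / 2 < 1" by simp
        \<comment> \<open>The dyadic position of |1 - z| / 2 in (0, 1) determines the annulus containing z.\<close>
        then have "0 \<le> 1 - cmod (1 - z) / 2" "1 - cmod (1 - z) / 2 < 1" using pos by auto
        then obtain m where "1 - cmod (1 - z) / 2 \<in> dyadic_interval m" by (rule dyadic_interval_cover)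
        then have m: "cmod (1 - z) \<le> ?r m" "(1/2)^m < cmod (1 - z)" by (auto simp: dyadic_interval_def)
        \<comment> \<open>The annuli are open on the outside, the dyadic intervals closed there: at equality the index shifts by one.\<close>
        obtain k where k: "(1/2)^k \<le> cmod (1 - z)" "cmod (1 - z) < ?r k"
        proof (cases "cmod (1 - z) = ?r m")
          case True
          then have "m \<noteq> 0" using \<open>cmod (1 - z) < 2\<close> by (intro notI) simp
          then obtain k where "m = Suc k" by (cases m) auto
          then show ?thesis using that[of k] True by simp
        next
          case False
          then show ?thesis using that[of m] m by simp
        qed
        have "besov_integrand p g z \<le> (1 - (cmod z)\<^sup>2) powr (p - 2) * a k"
          unfolding besov_integrand_def a_def
          using dg[OF z k(1)] p by (intro mult_left_mono powr_mono2) auto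
        then have "ennreal (besov_integrand p g z) \<le> ennreal (a k) * ?w z"
          by (subst ennreal_mult[symmetric]) (auto simp: a_def mult.commute intro!: ennreal_leI)
        then have "ennreal (besov_integrand p g z) * indicator unit_disc z
           \<le> ennreal (a k) * (?w z * indicator (ball 0 1 \<inter> ball 1 (?r k)) z)"
          using k(2) z by (simp add: dist_norm)
        also have "\<dots> = (\<Sum>m\<in>{k}. ennreal (a m) * (?w z * indicator (ball 0 1 \<inter> ball 1 (?r m)) z))"
          by (subst sum.insert) auto
        also have "\<dots> \<le> (\<Sum>m. ennreal (a m) * (?w z * indicator (ball 0 1 \<inter> ball 1 (?r m)) z))"
          by (rule sum_le_suminf) auto
        finally show ?thesis .
      qed simp
    qed
    also have "\<dots> = (\<Sum>m. \<integral>\<^sup>+z. ennreal (a m) * (?w z * indicator (ball 0 1 \<inter> ball 1 (?r m)) z) \<partial>lborel)"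
      by (rule nn_integral_suminf)
         (intro borel_measurable_times_ennreal borel_measurable_indicator; auto)
    also have "\<dots> = (\<Sum>m. ennreal (a m) * (\<integral>\<^sup>+z\<in>ball 0 1 \<inter> ball 1 (?r m). ?w z \<partial>lborel))"
      by (intro suminf_cong nn_integral_cmult borel_measurable_times_ennreal borel_measurable_indicator) auto
    also have "\<dots> \<le> (\<Sum>m. ennreal (W * 2 powr p * B powr p * real (m + 1) powr (-(\<delta> * p))))"
    proof (rule suminf_le)
      fix m :: nat
      have "ennreal (a m) * (\<integral>\<^sup>+z\<in>ball 0 1 \<inter> ball 1 (?r m). ?w z \<partial>lborel)
          \<le> ennreal (a m) * ennreal (W * ?r m powr ((p - 2) + 2))"
        by (intro mult_left_mono wt) (auto simp: power_le_one)
      also have "\<dots> = ennreal (a m * (W * ?r m powr p))"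
        using W by (subst ennreal_mult[symmetric]) (auto simp: a_def)
      also have "a m * (W * ?r m powr p) = W * 2 powr p * B powr p * real (m + 1) powr (-(\<delta> * p))"
      proof -
        have "a m = B powr p * ((2^m) powr p * real (m + 1) powr (-(\<delta> * p)))"
          unfolding a_def using B by (simp add: powr_mult powr_powr)
        moreover have "?r m powr p = 2 powr p * ((1/2)^m) powr p" by (simp add: powr_mult)
        moreover have "(2^m) powr p * ((1/2)^m) powr p = (1::real)"
          by (subst powr_mult[symmetric]) (auto simp: power_one_over)
        ultimately show ?thesis by (simp add: mult_ac)
      qed
      finally show "ennreal (a m) * (\<integral>\<^sup>+z\<in>ball 0 1 \<inter> ball 1 (?r m). ?w z \<partial>lborel)
          \<le> ennreal (W * 2 powr p * B powr p * real (m + 1) powr (-(\<delta> * p)))" .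
    qed auto
    also have "\<dots> = ennreal (\<Sum>m. W * 2 powr p * B powr p * real (m + 1) powr (-(\<delta> * p)))"
      using W by (intro suminf_ennreal2 summable_mult sm) auto
    also have "(\<Sum>m. W * 2 powr p * B powr p * real (m + 1) powr (-(\<delta> * p))) = K * B powr p"
      by (subst suminf_mult[OF sm]) (simp add: K_def S_def)
    finally show ?thesis .
  qed
  ultimately show ?thesis using that by blast
qed

theorem theorem3p8:
  fixes p \<gamma> :: real and \<mu> :: "real measure"
  assumes "1 < p" and "\<gamma> > 1"
    and "borel_measure_on_01 \<mu>"
    and "log_carleson \<gamma> 1 \<mu>"
  shows "(\<forall>f\<in>besov_space p. hankel_op_well_defined \<mu> f) \<and>
         besov_bounded_operator p (hankel_op \<mu>)"
proof -
  define \<delta> where "\<delta> = \<gamma> - (1 - 1 / p)"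
  have "\<delta> * p = (\<gamma> - 1) * p + 1" using assms(1) by (simp add: \<delta>_def field_simps)
  then have \<delta>: "\<delta> * p > 1" using assms(1,2) by simp
  obtain K where K: "K > 0" and ker:
    "\<And>f z m. \<lbrakk>f \<in> besov_space p; cmod z < 1; (1/2)^m \<le> cmod (1 - z)\<rbrakk> \<Longrightarrow>
       (\<integral>\<^sup>+t. ennreal (cmod (f (of_real t)) / (cmod (1 - of_real t * z))\<^sup>2) \<partial>\<mu>)
         \<le> ennreal (K * besov_norm p f * (2^m * real (m + 1) powr (-\<delta>)))"
    using hankel_kernel_bound[OF assms] unfolding \<delta>_def by blast
  obtain L where L: "L > 0" and en:
    "\<And>g B. \<lbrakk>B \<ge> 0; \<And>z m. \<lbrakk>cmod z < 1; (1/2)^m \<le> cmod (1 - z)\<rbrakk> \<Longrightarrow>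
          cmod (deriv g z) \<le> B * (2^m * real (m + 1) powr (-\<delta>))\<rbrakk>
       \<Longrightarrow> besov_energy p g unit_disc \<le> ennreal (L * B powr p)"
    using besov_energy_power_decay[OF assms(1) \<delta>] by blast
  obtain C where bloch:
    "\<And>f z. f \<in> besov_space p \<Longrightarrow> cmod z < 1 \<Longrightarrow> (1 - cmod z) * cmod (deriv f z) \<le> C * besov_norm p f"
    using besov_growth[OF assms(1)] by metis
  have setting: "\<exists>A. hankel_setting \<mu> f A" if f: "f \<in> besov_space p" for f
  proof -
    have hol: "f holomorphic_on unit_disc" using f by (simp add: besov_space_def)
    obtain A where "\<And>k. cmod (fps_nth (fps_expansion f 0) k) \<le> A"
      using taylor_coeffs_bounded[OF hol bloch[OF f]] by blast
    then have "hankel_setting \<mu> f A"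
      using hol assms(3) log_carleson_inverse_finite[OF assms(3,4,2)] by unfold_locales
    then show ?thesis ..
  qed
  have wd: "hankel_op_well_defined \<mu> f" if "f \<in> besov_space p" for f
    using setting[OF that] hankel_setting.hankel_op_well_defined by blast
  have bound: "hankel_op \<mu> f \<in> besov_space p \<and>
      besov_norm p (hankel_op \<mu> f) \<le> (K powr p + L * K powr p) powr (1 / p) * besov_norm p f"
    if f: "f \<in> besov_space p" for f
  proof -
    let ?N = "besov_norm p f" and ?T = "hankel_op \<mu> f"
    have N: "?N \<ge> 0" using besov_norm_bounds assms(1) by simp
    obtain A where "hankel_setting \<mu> f A" using setting[OF f] ..
    then interpret hankel_setting \<mu> f A .
    have dT: "cmod (deriv ?T z) \<le> K * ?N * (2^m * real (m + 1) powr (-\<delta>))"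
      if z: "cmod z < 1" and m: "(1/2)^m \<le> cmod (1 - z)" for z m
    proof -
      have "ennreal (cmod (deriv ?T z)) \<le> ennreal (K * ?N * (2^m * real (m + 1) powr (-\<delta>)))"
        using deriv_hankel_op_bound[OF z] ker[OF f z m] by (rule order_trans)
      then show ?thesis using K N by simp
    qed
    have energy: "besov_energy p ?T unit_disc \<le> ennreal (L * (K * ?N) powr p)"
      by (rule en) (use K N dT in auto)
    have p0: "p > 0" using assms(1) by simp
    note sp = besov_space_energyI[OF hankel_op_holomorphic p0 energy]
    have "L * (K * ?N) powr p \<ge> 0" using L by simp
    note sp = sp[OF this]
    \<comment> \<open>At z = 0 the kernel is 1, and m = 0 is admissible since |1 - 0| = 1.\<close>
    have "ennreal f_mass \<le> ennreal (K * ?N)"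
      using ker[OF f, of 0 0] by (simp add: nn_integral_f)
    then have "f_mass \<le> K * ?N" using K N by simp
    then have T0: "cmod (?T 0) \<le> K * ?N" using hankel_op_0 by linarith
    have "besov_norm p ?T \<le> ((K * ?N) powr p + L * (K * ?N) powr p) powr (1 / p)"
      unfolding besov_norm_def[of p ?T]
      using T0 sp(2) p0 by (intro powr_mono2 add_mono) auto
    also have "(K * ?N) powr p + L * (K * ?N) powr p = (K powr p + L * K powr p) * ?N powr p"
      using K N by (simp add: powr_mult algebra_simps)
    also have "\<dots> powr (1 / p) = (K powr p + L * K powr p) powr (1 / p) * ?N"
      using K L N p0 by (simp add: powr_mult powr_powr)
    finally show ?thesis using sp(1) by simp
  qed
  show ?thesis
    unfolding besov_bounded_operator_def
  proof (intro conjI ballI allI exI)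
    fix f g a b z assume f: "f \<in> besov_space p" and g: "g \<in> besov_space p" and z: "z \<in> unit_disc"
    show "hankel_op \<mu> (\<lambda>w. a * f w + b * g w) z = a * hankel_op \<mu> f z + b * hankel_op \<mu> g z"
      using f g by (intro hankel_op_linear wd z) (auto simp: besov_space_def)
  qed (use wd bound in auto)
qed

end
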